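(* Let $H$ be a separable Hilbert space, let $a>0$, and let $(A,B)$ be a pair of linear operators on $H$ such that: $A$ is skew-adjoint with domain $D(A)$; $\mathrm{i}A$ is bounded from below; $B$ is skew-symmetric; and $\|B\psi\|\le a\|A\psi\|$ for every $\psi\in D(A)$. Let $\delta\in(0,1)$, $T>0$, $u\in\mathcal{U}_{\delta,a}$, and let $(u_n)_{n\in\mathbf{N}}$ be a sequence of piecewise constant functions in $\mathcal{U}_{\delta,a}$ such that $u_n\to u$ pointwise and $TV_{[0,T]}(u_n)\le TV_{[0,T]}(u)$ for every $n\in\mathbf{N}$. Then for every $t\in[0,T]$ and every $\psi\in D(A)$, the sequence $(\Upsilon^{u_n}_{t,0}\psi)_{n\in\mathbf{N}}$ is a Cauchy sequence for the norm of $H$.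
   Context: $\mathcal{U}_{\delta,a}$ is the set of functions $u:\mathbf{R}\to\left(-\frac{1-\delta}{a},\frac{1-\delta}{a}\right)$ of bounded variation on $\mathbf{R}$ with $u(t)=0$ for all $t\le 0$. The total variation $TV_{[0,T]}(u)$ is the supremum over all partitions $0=a_0<a_1<\dots<a_n=T$ of $\sum_{k=1}^n|u(a_k)-u(a_{k-1})|$. By the Kato-Rellich theorem, for every real $v$ with $|v|<1/a$ the operator $A+vB$ is skew-adjoint with domain $D(A)$ and generates a unitary group $s\mapsto e^{s(A+vB)}$. For a piecewise constant control $u$ (constant on each of finitely many successive intervals partitioning $[0,t]$) taking successively the values $v_1,\dots,v_p$ on intervals of lengths $t_1,\dots,t_p\ge0$ with $t_1+\dots+t_p=t$, the propagator of $\frac{\mathrm{d}\psi}{\mathrm{d}t}=(A+u(t)B)\psi$ is $\Upsilon^u_{t,0}=e^{t_p(A+v_pB)}\cdots e^{t_1(A+v_1B)}$. *)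

theory Defs
  imports "HOL-Analysis.Analysis"
begin

class scaleC =
  fixes scaleC :: "complex \<Rightarrow> 'a \<Rightarrow> 'a"  (infixr "*\<^sub>C" 75)

class complex_inner = real_normed_vector + scaleC +
  fixes cinner :: "'a \<Rightarrow> 'a \<Rightarrow> complex"
  assumes scaleR_scaleC: "r *\<^sub>R x = complex_of_real r *\<^sub>C x"
    and scaleC_add_right: "c *\<^sub>C (x + y) = c *\<^sub>C x + c *\<^sub>C y"
    and scaleC_add_left: "(c + d) *\<^sub>C x = c *\<^sub>C x + d *\<^sub>C x"
    and scaleC_scaleC: "c *\<^sub>C d *\<^sub>C x = (c * d) *\<^sub>C x"
    and cinner_commute: "cinner x y = cnj (cinner y x)"
    and cinner_add_right: "cinner x (y + z) = cinner x y + cinner x z"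
    and cinner_scaleC_right: "cinner x (c *\<^sub>C y) = c * cinner x y"
    and cinner_self: "cinner x x = complex_of_real ((norm x)\<^sup>2)"

class chilbert_space = complex_inner + complete_space

text \<open>An unbounded operator is given by its domain \<open>D\<close> and a function \<open>L\<close> of which only the
  values on \<open>D\<close> matter.\<close>

definition csubspace :: "'h::complex_inner set \<Rightarrow> bool" where
  "csubspace D \<longleftrightarrow> 0 \<in> D \<and> (\<forall>x\<in>D. \<forall>y\<in>D. x + y \<in> D) \<and> (\<forall>c. \<forall>x\<in>D. c *\<^sub>C x \<in> D)"

definition linear_operator :: "'h::complex_inner set \<Rightarrow> ('h \<Rightarrow> 'h) \<Rightarrow> bool" where
  "linear_operator D L \<longleftrightarrow> csubspace D \<and>
     (\<forall>x\<in>D. \<forall>y\<in>D. L (x + y) = L x + L y) \<and> (\<forall>c. \<forall>x\<in>D. L (c *\<^sub>C x) = c *\<^sub>C L x)"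

definition densely_defined_operator :: "'h::complex_inner set \<Rightarrow> ('h \<Rightarrow> 'h) \<Rightarrow> bool" where
  "densely_defined_operator D L \<longleftrightarrow> linear_operator D L \<and> closure D = UNIV"

definition adjoint_graph :: "'h::complex_inner set \<Rightarrow> ('h \<Rightarrow> 'h) \<Rightarrow> ('h \<times> 'h) set" where
  "adjoint_graph D L = {(\<phi>, \<eta>). \<forall>\<psi>\<in>D. cinner \<phi> (L \<psi>) = cinner \<eta> \<psi>}"

definition skew_adjoint :: "'h::complex_inner set \<Rightarrow> ('h \<Rightarrow> 'h) \<Rightarrow> bool" where
  "skew_adjoint D L \<longleftrightarrow> densely_defined_operator D L \<and>
     adjoint_graph D L = (\<lambda>\<phi>. (\<phi>, - L \<phi>)) ` D"

definition skew_symmetric :: "'h::complex_inner set \<Rightarrow> ('h \<Rightarrow> 'h) \<Rightarrow> bool" where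
  "skew_symmetric D L \<longleftrightarrow> densely_defined_operator D L \<and>
     (\<forall>\<phi>\<in>D. \<forall>\<psi>\<in>D. cinner (L \<phi>) \<psi> = - cinner \<phi> (L \<psi>))"

definition bounded_from_below :: "'h::complex_inner set \<Rightarrow> ('h \<Rightarrow> 'h) \<Rightarrow> bool" where
  "bounded_from_below D L \<longleftrightarrow>
     (\<exists>c::real. \<forall>\<psi>\<in>D. Re (cinner \<psi> (L \<psi>)) \<ge> c * (norm \<psi>)\<^sup>2)"

definition unitary_operator :: "('h::complex_inner \<Rightarrow> 'h) \<Rightarrow> bool" where
  "unitary_operator V \<longleftrightarrow> linear_operator UNIV V \<and> surj V \<and>
     (\<forall>\<phi> \<psi>. cinner (V \<phi>) (V \<psi>) = cinner \<phi> \<psi>)"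

definition unitary_group :: "(real \<Rightarrow> 'h::complex_inner \<Rightarrow> 'h) \<Rightarrow> bool" where
  "unitary_group U \<longleftrightarrow> (\<forall>s. unitary_operator (U s)) \<and> U 0 = id \<and>
     (\<forall>s r. U (s + r) = U s \<circ> U r) \<and> (\<forall>\<psi>. continuous_on UNIV (\<lambda>s. U s \<psi>))"

text \<open>\<open>(D, L)\<close> is the infinitesimal generator of \<open>U\<close>: the derivative of \<open>s \<mapsto> U s \<psi>\<close> at \<open>0\<close>
  exists exactly for \<open>\<psi> \<in> D\<close>, and then equals \<open>L \<psi>\<close>.\<close>

definition generates ::
  "'h::complex_inner set \<Rightarrow> ('h \<Rightarrow> 'h) \<Rightarrow> (real \<Rightarrow> 'h \<Rightarrow> 'h) \<Rightarrow> bool" where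
  "generates D L U \<longleftrightarrow>
     (\<forall>\<psi> \<phi>. ((\<lambda>s. U s \<psi>) has_vector_derivative \<phi>) (at 0) \<longleftrightarrow> \<psi> \<in> D \<and> \<phi> = L \<psi>)"

text \<open>\<open>group_exp D L s\<close> is \<open>e\<^sup>s\<^sup>L\<close>; by Stone's theorem it is well defined for skew-adjoint \<open>L\<close>.\<close>

definition group_exp ::
  "'h::complex_inner set \<Rightarrow> ('h \<Rightarrow> 'h) \<Rightarrow> real \<Rightarrow> 'h \<Rightarrow> 'h" where
  "group_exp D L = (THE U. unitary_group U \<and> generates D L U)"

definition partition_of :: "real \<Rightarrow> real \<Rightarrow> nat \<Rightarrow> (nat \<Rightarrow> real) \<Rightarrow> bool" where
  "partition_of a b n \<sigma> \<longleftrightarrow> \<sigma> 0 = a \<and> \<sigma> n = b \<and> (\<forall>k<n. \<sigma> k < \<sigma> (Suc k))"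

definition variation_sum :: "(real \<Rightarrow> real) \<Rightarrow> nat \<Rightarrow> (nat \<Rightarrow> real) \<Rightarrow> real" where
  "variation_sum u n \<sigma> = (\<Sum>k<n. \<bar>u (\<sigma> (Suc k)) - u (\<sigma> k)\<bar>)"

definition total_variation :: "real \<Rightarrow> real \<Rightarrow> (real \<Rightarrow> real) \<Rightarrow> ereal" where
  "total_variation a b u = Sup {ereal (variation_sum u n \<sigma>) | n \<sigma>. partition_of a b n \<sigma>}"

definition bounded_variation :: "(real \<Rightarrow> real) \<Rightarrow> bool" where
  "bounded_variation u \<longleftrightarrow>
     (\<exists>M. \<forall>a b n \<sigma>. partition_of a b n \<sigma> \<longrightarrow> variation_sum u n \<sigma> \<le> M)"

definition admissible_controls :: "real \<Rightarrow> real \<Rightarrow> (real \<Rightarrow> real) set" where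
  "admissible_controls \<delta> a =
     {u. range u \<subseteq> {- ((1 - \<delta>) / a) <..< (1 - \<delta>) / a} \<and> bounded_variation u \<and> (\<forall>t\<le>0. u t = 0)}"

text \<open>\<open>steps u t ps\<close>: the list \<open>ps\<close> of pairs (value, interval) describes \<open>u\<close> on \<open>[0, t]\<close> by finitely
  many successive intervals, of any kind (possibly single points), on each of which \<open>u\<close> is
  constant.\<close>

definition steps :: "(real \<Rightarrow> real) \<Rightarrow> real \<Rightarrow> (real \<times> real set) list \<Rightarrow> bool" where
  "steps u t ps \<longleftrightarrow>
     (\<forall>(v, I) \<in> set ps. is_interval I \<and> I \<noteq> {} \<and> (\<forall>r\<in>I. u r = v)) \<and>
     sorted_wrt (\<lambda>(_, I) (_, J). \<forall>x\<in>I. \<forall>y\<in>J. x < y) ps \<and>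
     (\<Union>(v, I) \<in> set ps. I) = {0..t}"

definition piecewise_constant :: "(real \<Rightarrow> real) \<Rightarrow> real \<Rightarrow> bool" where
  "piecewise_constant u t \<longleftrightarrow> (\<exists>ps. steps u t ps)"

text \<open>\<open>control_exp DA A DB B v s\<close> is \<open>e\<close> to the power \<open>s (A + v B)\<close>, where \<open>A + v B\<close> has the usual domain
  \<open>DA \<inter> DB\<close> of a sum.\<close>

definition control_exp ::
  "'h::complex_inner set \<Rightarrow> ('h \<Rightarrow> 'h) \<Rightarrow> 'h set \<Rightarrow> ('h \<Rightarrow> 'h) \<Rightarrow> real \<Rightarrow> real \<Rightarrow> 'h \<Rightarrow> 'h" where
  "control_exp DA A DB B v = group_exp (DA \<inter> DB) (\<lambda>\<psi>. A \<psi> + v *\<^sub>R B \<psi>)"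

text \<open>The first interval of the list acts first.\<close>

definition steps_propagator ::
  "'h::complex_inner set \<Rightarrow> ('h \<Rightarrow> 'h) \<Rightarrow> 'h set \<Rightarrow> ('h \<Rightarrow> 'h) \<Rightarrow> (real \<times> real set) list \<Rightarrow> 'h \<Rightarrow> 'h" where
  "steps_propagator DA A DB B ps =
     fold (\<lambda>(v, I). control_exp DA A DB B v (Sup I - Inf I)) ps"

text \<open>\<open>propagator DA A DB B u t\<close> is the propagator from time \<open>0\<close> to time \<open>t\<close> of
  \<open>\<psi>' = (A + u(t) B) \<psi>\<close> for a piecewise constant \<open>u\<close>; the product of exponentials does not depend on
  the chosen description of \<open>u\<close> by steps.\<close>

definition propagator ::
  "'h::complex_inner set \<Rightarrow> ('h \<Rightarrow> 'h) \<Rightarrow> 'h set \<Rightarrow> ('h \<Rightarrow> 'h) \<Rightarrow> (real \<Rightarrow> real) \<Rightarrow> real \<Rightarrow> 'h \<Rightarrow> 'h" where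
  "propagator DA A DB B u t = steps_propagator DA A DB B (SOME ps. steps u t ps)"

end

theory Submission
  imports Defs
begin

text \<open>
  Every trajectory \<open>f\<close> of a piecewise constant control \<open>u\<close> solves \<open>f' = (A + u B) f\<close> away from the
  switching times, and \<open>A + u B\<close> is skew. For two controls \<open>u\<close>, \<open>w\<close> with trajectories \<open>f\<close>, \<open>g\<close>
  from the same initial state this gives \<open>(\<parallel>f - g\<parallel>\<^sup>2)' = 2 Re \<langle>f - g, (u - w) B g\<rangle>\<close>, so that
  \<open>\<parallel>f - g\<parallel>\<^sup>2\<close> at time \<open>t\<close> is bounded by a multiple of \<open>\<parallel>\<psi>\<parallel> sup \<parallel>B g\<parallel> \<integral>\<bar>u - w\<bar>\<close>
  (\<open>trajectory_diff\<close>). The controls \<open>un n\<close> converge pointwise and are uniformly bounded, hence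
  they converge in \<open>L\<^sup>1(0, t)\<close>. It remains to bound \<open>\<parallel>B g\<parallel>\<close> uniformly in \<open>n\<close>, and this is where
  bounded variation enters (\<open>steps_trajectory\<close>): while the control has the value \<open>v\<close>, the group
  conserves \<open>\<parallel>(A + v B) g\<parallel>\<close>, which is at least \<open>\<delta> \<parallel>A g\<parallel>\<close> because \<open>\<bar>v\<bar> a \<le> 1 - \<delta>\<close>, and each jump of
  the control multiplies it by at most \<open>exp (a \<bar>jump\<bar> / \<delta>)\<close>. Thus \<open>\<parallel>A g\<parallel>\<close>, and with it
  \<open>\<parallel>B g\<parallel> \<le> a \<parallel>A g\<parallel>\<close>, is controlled by the exponential of the total variation.

  This argument presupposes that \<open>A + v B\<close> generates a unitary group with domain \<open>D(A)\<close> and that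
  this group is unique, so that the operator exponentials have their intended meaning. Existence
  rests on the surjectivity of \<open>1 - r L\<close> for all real \<open>r \<noteq> 0\<close>, where \<open>L = A + v B\<close>. For a
  skew-adjoint operator such surjectivity follows from orthogonal projection onto the closed range
  (\<open>skew_adjoint_imp_maximal_skew\<close>), and it passes from \<open>A\<close> to \<open>A + v B\<close> by a contraction argument
  (\<open>kato_rellich\<close>). The group is then the limit of the exponentials of bounded skew Yosida
  approximations (\<open>group_exp_eq_evolution\<close>). The proofs of convergence and uniqueness are again
  energy estimates on \<open>\<parallel>f\<parallel>\<^sup>2\<close>.
\<close>

section \<open>The real inner product and orthogonal projection\<close>

instance chilbert_space \<subseteq> banach ..

lemma Re_cinner_commute: "Re (cinner x y) = Re (cinner y x)"
  by (metis cinner_commute complex_cnj(1) complex.sel(1) complex_surj)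

lemma cinner_add_left: "cinner (x + y) z = cinner x z + cinner y z"
  by (metis cinner_add_right cinner_commute complex_cnj_add)

lemma cinner_scaleR_right: "cinner x (r *\<^sub>R y) = of_real r * cinner x y"
  by (simp add: scaleR_scaleC cinner_scaleC_right)

lemma cinner_scaleC_left: "cinner (c *\<^sub>C x) y = cnj c * cinner x y"
  by (metis cinner_scaleC_right cinner_commute complex_cnj_mult)

lemma cinner_scaleR_left: "cinner (r *\<^sub>R x) y = of_real r * cinner x y"
  by (simp add: scaleR_scaleC cinner_scaleC_left)

lemma Re_cinner_self: "Re (cinner x x) = (norm x)\<^sup>2"
  by (simp add: cinner_self del: of_real_power)

lemma norm_add_sq: "(norm (x + y))\<^sup>2 = (norm x)\<^sup>2 + 2 * Re (cinner x y) + (norm y)\<^sup>2"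
  for x y :: "'h::complex_inner"
  using Re_cinner_commute[of x y]
  by (simp add: Re_cinner_self[symmetric] cinner_add_left cinner_add_right)

text \<open>The norm is part of the class and satisfies the triangle inequality; comparing the expansion
  of \<open>\<parallel>x + y\<parallel>\<^sup>2\<close> with \<open>(\<parallel>x\<parallel> + \<parallel>y\<parallel>)\<^sup>2\<close> turns this into the Cauchy--Schwarz inequality.\<close>

lemma Re_cinner_le: "Re (cinner x y) \<le> norm x * norm y"
proof -
  have "(norm (x + y))\<^sup>2 \<le> (norm x + norm y)\<^sup>2"
    by (intro power_mono norm_triangle_ineq norm_ge_zero)
  then show ?thesis unfolding norm_add_sq by (simp add: power2_sum)
qed

lemma cinner_zero_right [simp]: "cinner x 0 = 0"
  using cinner_add_right[of x 0 0] by simp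

lemma cinner_minus_right [simp]: "cinner x (- y) = - cinner x y"
  using cinner_scaleR_right[of x "-1" y] by simp

lemma cinner_minus_left [simp]: "cinner (- x) y = - cinner x y"
  by (metis cinner_minus_right cinner_commute complex_cnj_minus)

lemma cinner_diff_right: "cinner x (y - z) = cinner x y - cinner x z"
  using cinner_add_right[of x y "- z"] by simp

lemma cinner_diff_left: "cinner (x - y) z = cinner x z - cinner y z"
  using cinner_add_left[of x "- y" z] by simp

lemma abs_Re_cinner_le: "\<bar>Re (cinner x y)\<bar> \<le> norm x * norm y"
  using Re_cinner_le[of x y] Re_cinner_le[of "- x" y] by simp

text \<open>The real part of the inner product is a real inner product, and all estimates on derivatives
  and limits use only this bilinear form.\<close>

lemma bounded_bilinear_Re_cinner: "bounded_bilinear (\<lambda>x y. Re (cinner x y))"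
proof (rule bounded_bilinear.intro)
  show "\<exists>K. \<forall>a b. norm (Re (cinner a b)) \<le> norm a * norm b * K"
    by (rule exI[of _ 1]) (simp add: abs_Re_cinner_le)
qed (simp_all add: cinner_add_left cinner_add_right cinner_scaleC_right cinner_scaleC_left
    scaleR_scaleC)

lemma norm_diff_sq: "(norm (x - y))\<^sup>2 = (norm x)\<^sup>2 - 2 * Re (cinner x y) + (norm y)\<^sup>2"
  for x y :: "'h::complex_inner"
  using norm_add_sq[of x "- y"] by simp

lemma norm_scaleC: "norm (c *\<^sub>C (x::'h::complex_inner)) = cmod c * norm x"
proof -
  have "complex_of_real ((norm (c *\<^sub>C x))\<^sup>2) = complex_of_real ((cmod c * norm x)\<^sup>2)"
    unfolding cinner_self[symmetric] cinner_scaleC_left cinner_scaleC_right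
    unfolding cinner_self of_real_mult power_mult_distrib complex_norm_square
    by (simp only: mult_ac)
  then show ?thesis
    unfolding of_real_eq_iff by (simp add: power2_eq_iff_nonneg)
qed

lemma bounded_linear_scaleC: "bounded_linear (\<lambda>x::'h::complex_inner. c *\<^sub>C x)"
  by (rule bounded_linear_intro[of _ "cmod c"])
     (simp_all add: scaleC_add_right scaleR_scaleC scaleC_scaleC norm_scaleC mult.commute)

lemma scaleC_diff_right: "c *\<^sub>C (x - y) = c *\<^sub>C x - c *\<^sub>C (y::'h::complex_inner)"
  by (rule linear_diff[OF bounded_linear.linear[OF bounded_linear_scaleC]])

text \<open>Complex orthogonality relations follow from real ones by replacing the second vector \<open>y\<close> by
  \<open>\<i> y\<close>.\<close>

lemma Im_cinner_eq: "Im (cinner x y) = - Re (cinner x (\<i> *\<^sub>C y))"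
  by (simp add: cinner_scaleC_right)

lemma parallelogram: "(norm (x + y))\<^sup>2 + (norm (x - y))\<^sup>2 = 2 * (norm x)\<^sup>2 + 2 * (norm y)\<^sup>2"
  for x y :: "'h::complex_inner"
  unfolding norm_add_sq norm_diff_sq by simp

text \<open>The distance from a point \<open>y\<close> outside \<open>M\<close> to \<open>M\<close> is attained: a minimising sequence is
  Cauchy by the parallelogram law. The difference between \<open>y\<close> and the nearest point is orthogonal
  to \<open>M\<close>, since otherwise a small step inside \<open>M\<close> would decrease the distance.\<close>

lemma orthogonal_complement_nontrivial:
  fixes M :: "'h::chilbert_space set"
  assumes M: "subspace M" and "closed M" and "M \<noteq> UNIV"
  shows "\<exists>z. z \<noteq> 0 \<and> (\<forall>m\<in>M. Re (cinner z m) = 0)"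
proof -
  obtain y where y: "y \<notin> M" using \<open>M \<noteq> UNIV\<close> by blast
  have ne: "M \<noteq> {}" using subspace_0[OF M] by blast
  define d where "d = infdist y M"
  have d_le: "d \<le> norm (y - m)" if "m \<in> M" for m
    using infdist_le[OF that, of y] by (simp add: d_def dist_norm)
  have d0: "d \<ge> 0" by (simp add: d_def infdist_nonneg)
  have "\<exists>m\<in>M. (norm (y - m))\<^sup>2 < d\<^sup>2 + 1 / real (Suc n)" for n
  proof (rule ccontr)
    assume "\<not> ?thesis"
    then have "sqrt (d\<^sup>2 + 1 / real (Suc n)) \<le> dist y m" if "m \<in> M" for m
      using that real_sqrt_le_mono[of "d\<^sup>2 + 1 / real (Suc n)" "(norm (y - m))\<^sup>2"]
      by (auto simp: not_less dist_norm)
    then have "sqrt (d\<^sup>2 + 1 / real (Suc n)) \<le> d"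
      unfolding d_def infdist_notempty[OF ne] by (intro cINF_greatest ne)
    moreover have "d < sqrt (d\<^sup>2 + 1 / real (Suc n))"
      by (rule real_less_rsqrt) simp
    ultimately show False by simp
  qed
  then obtain m where mM: "\<And>n. m n \<in> M"
    and m: "\<And>n. (norm (y - m n))\<^sup>2 < d\<^sup>2 + 1 / real (Suc n)" by metis
  have key: "(norm (m j - m k))\<^sup>2 \<le> 2 / real (Suc j) + 2 / real (Suc k)" for j k
  proof -
    let ?c = "(1/2) *\<^sub>R (m j + m k)"
    have "?c \<in> M" by (intro subspace_scale subspace_add M mM)
    then have "d\<^sup>2 \<le> (norm (y - ?c))\<^sup>2" using d_le d0 by (intro power_mono) auto
    moreover have "(y - m k) + (y - m j) = 2 *\<^sub>R (y - ?c)"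
      by (simp add: scaleR_right_diff_distrib scaleR_2)
    then have "(norm ((y - m k) + (y - m j)))\<^sup>2 = 4 * (norm (y - ?c))\<^sup>2"
      by (metis norm_scaleR power_mult_distrib abs_numeral power2_eq_square mult_numeral_1 num_double
          numeral_times_numeral)
    ultimately show ?thesis
      using parallelogram[of "y - m k" "y - m j"] m[of j] m[of k] by simp
  qed
  have "Cauchy m"
  proof (rule metric_CauchyI)
    fix e :: real assume "e > 0"
    obtain N where N: "4 / e\<^sup>2 < real N" using reals_Archimedean2 by blast
    have "dist (m j) (m k) < e" if "j \<ge> N" "k \<ge> N" for j k
    proof -
      have "4 / real (Suc N) < e\<^sup>2" 
      proof -
        have "4 < real N * e\<^sup>2" using N \<open>e > 0\<close> by (simp add: field_simps)
        moreover have "0 < e\<^sup>2" using \<open>e > 0\<close> by simp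
        ultimately have "4 < real N * e\<^sup>2 + e\<^sup>2" by linarith
        then show ?thesis by (simp add: field_simps)
      qed
      moreover have "2 / real (Suc j) \<le> 2 / real (Suc N)" "2 / real (Suc k) \<le> 2 / real (Suc N)"
        using that by (auto intro!: divide_left_mono)
      ultimately have "(norm (m j - m k))\<^sup>2 < e\<^sup>2" using key[of j k] by simp
      then show ?thesis
        using \<open>e > 0\<close> by (simp add: dist_norm power2_less_imp_less)
    qed
    then show "\<exists>M. \<forall>k\<ge>M. \<forall>n\<ge>M. dist (m k) (m n) < e" by blast
  qed
  then obtain p where p: "m \<longlonglongrightarrow> p" using Cauchy_convergent convergent_def by blast
  have pM: "p \<in> M" by (rule closed_sequentially[OF \<open>closed M\<close> mM p])
  have "(\<lambda>n. (norm (y - m n))\<^sup>2) \<longlonglongrightarrow> (norm (y - p))\<^sup>2" by (intro tendsto_intros p)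
  moreover have "(\<lambda>n. d\<^sup>2 + 1 / real (Suc n)) \<longlonglongrightarrow> d\<^sup>2 + 0"
    using LIMSEQ_inverse_real_of_nat by (intro tendsto_intros) (simp add: inverse_eq_divide)
  ultimately have pd: "(norm (y - p))\<^sup>2 \<le> d\<^sup>2 + 0"
    by (rule LIMSEQ_le) (use m less_imp_le in blast)
  have "Re (cinner (y - p) w) = 0" if w: "w \<in> M" for w
  proof (rule ccontr)
    let ?r = "Re (cinner (y - p) w)"
    assume r: "?r \<noteq> 0"
    then have w0: "norm w > 0" by auto
    \<comment> \<open>The multiple of \<open>w\<close> that is nearest to \<open>y - p\<close>.\<close>
    define s where "s = ?r / (norm w)\<^sup>2"
    have "p + s *\<^sub>R w \<in> M" by (intro subspace_scale subspace_add M pM w)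
    then have "d\<^sup>2 \<le> (norm (y - (p + s *\<^sub>R w)))\<^sup>2" using d_le d0 by (intro power_mono) auto
    also have "y - (p + s *\<^sub>R w) = (y - p) - s *\<^sub>R w" by simp
    also have "(norm \<dots>)\<^sup>2 = (norm (y - p))\<^sup>2 - 2 * s * ?r + s\<^sup>2 * (norm w)\<^sup>2"
      unfolding norm_diff_sq by (simp add: cinner_scaleR_right power_mult_distrib)
    also have "\<dots> = (norm (y - p))\<^sup>2 - ?r\<^sup>2 / (norm w)\<^sup>2"
      using w0 by (simp add: s_def power2_eq_square field_simps)
    finally have "?r\<^sup>2 / (norm w)\<^sup>2 \<le> 0" using pd by simp
    then show False using r w0 by (simp add: divide_le_0_iff)
  qed
  moreover have "y - p \<noteq> 0" using pM y by auto
  ultimately show ?thesis by blast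
qed

section \<open>Exponentials of bounded skew operators\<close>

lemma has_real_derivative_norm_sq:
  fixes f :: "real \<Rightarrow> 'h::complex_inner"
  assumes "(f has_vector_derivative f') (at s)"
  shows "((\<lambda>s. (norm (f s))\<^sup>2) has_real_derivative 2 * Re (cinner (f s) f')) (at s)"
proof -
  have "((\<lambda>s. Re (cinner (f s) (f s))) has_vector_derivative
      (Re (cinner (f s) f') + Re (cinner f' (f s)))) (at s)"
    by (rule bounded_bilinear.has_vector_derivative[OF bounded_bilinear_Re_cinner assms assms])
  then show ?thesis
    unfolding has_real_derivative_iff_has_vector_derivative Re_cinner_self
    by (simp add: Re_cinner_commute[of f'])
qed

lemma norm_diff_le_of_derivative_bound:
  fixes f :: "real \<Rightarrow> 'a::real_normed_vector"
  assumes "\<And>s. \<bar>s\<bar> \<le> \<bar>t\<bar> \<Longrightarrow> (f has_vector_derivative f' s) (at s)"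
    and "\<And>s. \<bar>s\<bar> \<le> \<bar>t\<bar> \<Longrightarrow> norm (f' s) \<le> C"
  shows "norm (f t - f 0) \<le> C * \<bar>t\<bar>"
proof -
  have "norm (f t - f 0) \<le> C * norm (t - 0)"
  proof (rule differentiable_bound[where S = "{- \<bar>t\<bar>..\<bar>t\<bar>}" and f' = "\<lambda>s h. h *\<^sub>R f' s"])
    fix s assume "s \<in> {- \<bar>t\<bar>..\<bar>t\<bar>}"
    then have s: "\<bar>s\<bar> \<le> \<bar>t\<bar>" by auto
    show "(f has_derivative (\<lambda>h. h *\<^sub>R f' s)) (at s within {- \<bar>t\<bar>..\<bar>t\<bar>})"
      using assms(1)[OF s] unfolding has_vector_derivative_def by (rule has_derivative_at_withinI)
    show "onorm (\<lambda>h. h *\<^sub>R f' s) \<le> C"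
      using assms(2)[OF s] order_trans[OF norm_ge_zero assms(2)[OF s]]
      by (intro onorm_bound) (auto simp: mult.commute[of C] intro: mult_left_mono)
  qed auto
  then show ?thesis by simp
qed

text \<open>The energy method: differential equations for \<open>f\<close> enter only through the derivative of
  \<open>\<parallel>f\<parallel>\<^sup>2\<close>, in which skew terms cancel.\<close>

lemma norm_sq_diff_le:
  fixes f :: "real \<Rightarrow> 'h::complex_inner"
  assumes "\<And>s. (f has_vector_derivative f' s) (at s)"
    and "\<And>s. \<bar>2 * Re (cinner (f s) (f' s))\<bar> \<le> C"
  shows "\<bar>(norm (f t))\<^sup>2 - (norm (f 0))\<^sup>2\<bar> \<le> C * \<bar>t\<bar>"
proof -
  have "norm ((norm (f t))\<^sup>2 - (norm (f 0))\<^sup>2) \<le> C * \<bar>t\<bar>"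
  proof (rule norm_diff_le_of_derivative_bound)
    fix s
    show "((\<lambda>t. (norm (f t))\<^sup>2) has_vector_derivative 2 * Re (cinner (f s) (f' s))) (at s)"
      using has_real_derivative_norm_sq[OF assms(1)]
      unfolding has_real_derivative_iff_has_vector_derivative .
  qed (use assms(2) in auto)
  then show ?thesis by simp
qed

lemma norm_funpow_le:
  fixes K :: "'a::real_normed_vector \<Rightarrow> 'a"
  assumes "bounded_linear K" and M: "\<And>y. norm (K y) \<le> norm y * M" and "M \<ge> 0"
  shows "norm ((K ^^ n) x) \<le> norm x * M ^ n"
proof (induction n)
  case (Suc n)
  have "norm ((K ^^ Suc n) x) \<le> norm ((K ^^ n) x) * M" using M[of "(K ^^ n) x"] by simp
  also have "\<dots> \<le> norm x * M ^ n * M" using Suc \<open>M \<ge> 0\<close> by (intro mult_right_mono)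
  finally show ?case by (simp add: algebra_simps)
qed simp

text \<open>The solution is the exponential series \<open>\<Sum>t\<^sup>n K\<^sup>n x / n!\<close>, differentiated term by term. The
  constant term is kept apart, so that the derivative of the \<open>n\<close>-th remaining term \<open>F n\<close> is the
  \<open>n\<close>-th term \<open>G n\<close> of the differentiated series, which is again the exponential series with \<open>K\<close>
  applied to it.\<close>

lemma bounded_linear_ode_solution:
  fixes K :: "'a::banach \<Rightarrow> 'a"
  assumes "bounded_linear K"
  shows "\<exists>f. f 0 = x \<and> (\<forall>t. (f has_vector_derivative K (f t)) (at t))"
proof -
  interpret K: bounded_linear K by fact
  obtain M where M0: "M \<ge> 0" and M: "\<And>y. norm (K y) \<le> norm y * M"
    using K.nonneg_bounded by blast
  define F where "F n s = (s ^ Suc n / fact (Suc n)) *\<^sub>R (K ^^ Suc n) x" for n and s :: real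
  define G where "G n s = (s ^ n / fact n) *\<^sub>R (K ^^ Suc n) x" for n and s :: real
  define f where "f s = x + (\<Sum>n. F n s)" for s
  have K_F: "K (F n s) = G (Suc n) s" for n s
    by (simp add: F_def G_def K.scaleR)
  have main: "(f has_vector_derivative K (f t)) (at t)" for t
  proof -
    define R where "R = \<bar>t\<bar> + 1"
    have R: "R \<ge> 0" by (simp add: R_def)
    have G_le: "norm (G n s) \<le> (norm x * M) * ((R * M) ^ n / fact n)" if "s \<in> ball 0 R" for n s
    proof -
      have "norm (G n s) = \<bar>s\<bar> ^ n / fact n * norm ((K ^^ Suc n) x)"
        unfolding G_def norm_scaleR by (simp add: power_abs)
      also have "\<dots> \<le> R ^ n / fact n * (norm x * M ^ Suc n)"
        using that R M0
        by (intro mult_mono divide_right_mono power_mono norm_funpow_le[OF assms M M0]) auto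
      finally show ?thesis by (simp add: power_mult_distrib field_simps)
    qed
    have summ: "summable (\<lambda>n. (norm x * M) * ((R * M) ^ n / fact n))"
      using summable_exp[of "R * M"] by (intro summable_mult) (simp add: field_simps)
    have unif: "uniform_limit (ball 0 R) (\<lambda>n s. \<Sum>i<n. G i s) (\<lambda>s. \<Sum>i. G i s) sequentially"
      by (rule Weierstrass_m_test[OF G_le summ])
    have "\<exists>g. \<forall>s\<in>ball 0 R. (\<lambda>n. F n s) sums (g s) \<and>
        (g has_derivative (\<lambda>h. h *\<^sub>R (\<Sum>i. G i s))) (at s within ball 0 R)"
    proof (rule has_derivative_series[where x = 0 and l = 0])
      fix n and s :: real
      have "((\<lambda>s. s ^ Suc n / fact (Suc n)) has_real_derivative s ^ n / fact n)
          (at s within ball 0 R)"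
        by (rule derivative_eq_intros refl | simp)+
      then show "(F n has_derivative (\<lambda>h. h *\<^sub>R G n s)) (at s within ball 0 R)"
        unfolding F_def G_def has_field_derivative_def
        by (rule has_derivative_eq_rhs[OF has_derivative_scaleR_left])
            (simp add: fun_eq_iff mult.commute)
    next
      fix e :: real assume "e > 0"
      from uniform_limitD[OF unif this]
      show "\<forall>\<^sub>F n in sequentially. \<forall>s\<in>ball 0 R. \<forall>h.
          norm ((\<Sum>i<n. h *\<^sub>R G i s) - h *\<^sub>R (\<Sum>i. G i s)) \<le> e * norm h"
      proof eventually_elim
        case (elim n)
        show ?case
        proof (intro ballI allI)
          fix s h :: real assume "s \<in> ball 0 R"
          then have "norm ((\<Sum>i<n. G i s) - (\<Sum>i. G i s)) \<le> e"
            using elim by (auto simp: dist_norm intro: less_imp_le)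
          then show "norm ((\<Sum>i<n. h *\<^sub>R G i s) - h *\<^sub>R (\<Sum>i. G i s)) \<le> e * norm h"
            unfolding scaleR_sum_right[symmetric] scaleR_diff_right[symmetric] norm_scaleR
            by (simp add: mult.commute[of e] mult_left_mono)
        qed
      qed
    next
      show "0 \<in> ball 0 R" by (simp add: R_def)
      show "(\<lambda>n. F n 0) sums 0" by (simp add: F_def)
    qed simp
    then obtain g where g: "\<And>s. s \<in> ball 0 R \<Longrightarrow> (\<lambda>n. F n s) sums (g s)"
      and g': "\<And>s. s \<in> ball 0 R \<Longrightarrow> (g has_derivative (\<lambda>h. h *\<^sub>R (\<Sum>i. G i s))) (at s within ball 0 R)"
      by blast
    have t: "t \<in> ball 0 R" by (simp add: R_def)
    have "((\<lambda>s. x + g s) has_vector_derivative (\<Sum>i. G i t)) (at t)"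
      using g'[OF t] unfolding has_vector_derivative_def at_within_open[OF t open_ball]
      by (rule has_derivative_eq_rhs[OF has_derivative_add[OF has_derivative_const]]) simp
    then have "(f has_vector_derivative (\<Sum>i. G i t)) (at t)"
      by (rule has_vector_derivative_transform_within_open[OF _ open_ball t])
         (simp add: f_def sums_unique[OF g])
    moreover have "(\<lambda>n. G (Suc n) t) sums K (g t)"
      using K.sums[OF g[OF t]] by (simp add: K_F)
    then have "(\<lambda>n. G n t) sums (K (g t) + G 0 t)"
      by (rule sums_Suc)
    then have "(\<Sum>i. G i t) = K (f t)"
      by (simp add: sums_unique[symmetric] f_def K.add G_def sums_unique[OF g[OF t], symmetric])
    ultimately show ?thesis by simp
  qed
  have "F n 0 = 0" for n by (simp add: F_def)
  then have "f 0 = x" by (simp add: f_def)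
  with main show ?thesis by blast
qed

text \<open>For bounded \<open>K\<close>, \<open>flow K x t\<close> is \<open>e\<^sup>t\<^sup>K x\<close>. Its linearity and the group law come from the
  uniqueness of solutions.\<close>

definition flow :: "('h::chilbert_space \<Rightarrow> 'h) \<Rightarrow> 'h \<Rightarrow> real \<Rightarrow> 'h" where
  "flow K x = (SOME f. f 0 = x \<and> (\<forall>t. (f has_vector_derivative K (f t)) (at t)))"

locale bounded_skew =
  fixes K :: "'h::chilbert_space \<Rightarrow> 'h"
  assumes bounded_linear: "bounded_linear K"
    and skew: "Re (cinner x (K x)) = 0"
begin

sublocale bounded_linear K by (rule bounded_linear)

lemma flow_0 [simp]: "flow K x 0 = x"
  and flow_deriv: "(flow K x has_vector_derivative K (flow K x t)) (at t)"
  using someI_ex[OF bounded_linear_ode_solution[OF bounded_linear, of x]]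
  unfolding flow_def by auto

lemma ode_norm:
  assumes "\<And>t. (f has_vector_derivative K (f t)) (at t)"
  shows "norm (f t) = norm (f 0)"
proof -
  have "\<bar>(norm (f t))\<^sup>2 - (norm (f 0))\<^sup>2\<bar> \<le> 0 * \<bar>t\<bar>"
    by (rule norm_sq_diff_le[OF assms]) (simp add: skew)
  then show ?thesis by simp
qed

lemma flow_norm [simp]: "norm (flow K x t) = norm x"
  using ode_norm[OF flow_deriv, of x t] by simp

lemma flow_unique:
  assumes f: "\<And>t. (f has_vector_derivative K (f t)) (at t)" and "f 0 = x"
  shows "f t = flow K x t"
proof -
  have "norm (f t - flow K x t) = norm (f 0 - flow K x 0)"
    \<comment> \<open>The difference of two solutions solves the same linear equation, so its norm is constant.\<close>
    by (rule ode_norm) (auto intro!: derivative_eq_intros f flow_deriv simp: diff)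
  then show ?thesis using \<open>f 0 = x\<close> by simp
qed

lemma flow_commute:
  assumes M: "bounded_linear M" and "\<And>y. M (K y) = K (M y)"
  shows "M (flow K x t) = flow K (M x) t"
proof (rule flow_unique[of "\<lambda>t. M (flow K x t)"])
  show "((\<lambda>t. M (flow K x t)) has_vector_derivative K (M (flow K x t))) (at t)" for t
    using bounded_linear.has_vector_derivative[OF M flow_deriv[of x t]] assms(2) by simp
qed simp

lemma flow_add: "flow K (x + y) t = flow K x t + flow K y t"
  by (rule flow_unique[symmetric]) (auto intro!: derivative_eq_intros flow_deriv simp: add)

lemma flow_diff: "flow K (x - y) t = flow K x t - flow K y t"
  by (rule flow_unique[symmetric]) (auto intro!: derivative_eq_intros flow_deriv simp: diff)

lemma flow_group: "flow K x (s + t) = flow K (flow K x s) t"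
proof (rule flow_unique[of "\<lambda>t. flow K x (s + t)"])
  fix t
  have "((\<lambda>t. s + t) has_vector_derivative 1) (at t)" by (auto intro!: derivative_eq_intros)
  from vector_diff_chain_at[OF this flow_deriv]
  show "((\<lambda>t. flow K x (s + t)) has_vector_derivative K (flow K x (s + t))) (at t)"
    by (simp add: o_def)
qed simp

lemma norm_flow_diff_le: "norm (flow K x t - x) \<le> norm (K x) * \<bar>t\<bar>"
proof -
  have "norm (flow K x t - flow K x 0) \<le> norm (K x) * \<bar>t\<bar>"
    by (rule norm_diff_le_of_derivative_bound[OF flow_deriv])
       (simp add: flow_commute[OF bounded_linear])
  then show ?thesis by simp
qed

text \<open>The remainder of the first order expansion is controlled by how far the flow moves \<open>K x\<close>;
  this form survives the passage to an unbounded limit of such operators \<open>K\<close>.\<close>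

lemma norm_flow_taylor_le:
  assumes "\<And>s. \<bar>s\<bar> \<le> \<bar>t\<bar> \<Longrightarrow> norm (flow K (K x) s - K x) \<le> C"
  shows "norm (flow K x t - x - t *\<^sub>R K x) \<le> C * \<bar>t\<bar>"
proof -
  have "norm ((flow K x t - t *\<^sub>R K x) - (flow K x 0 - 0 *\<^sub>R K x)) \<le> C * \<bar>t\<bar>"
    by (rule norm_diff_le_of_derivative_bound[where f' = "\<lambda>s. K (flow K x s) - K x"])
       (auto intro!: derivative_eq_intros flow_deriv simp: flow_commute[OF bounded_linear] assms)
  then show ?thesis by (simp add: algebra_simps)
qed

end

text \<open>In the derivative of \<open>\<parallel>flow K x t - flow M x t\<parallel>\<^sup>2\<close> the term with \<open>K\<close> applied to the
  difference vanishes, and what remains is the flow of \<open>M\<close> applied to \<open>K x - M x\<close> because the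
  operators commute. Bounding the difference of the flows crudely by \<open>2 \<parallel>x\<parallel>\<close> avoids a Gronwall
  argument.\<close>

lemma flow_compare:
  assumes "bounded_skew K" "bounded_skew M" and comm: "\<And>y. K (M y) = M (K y)"
  shows "(norm (flow K x t - flow M x t))\<^sup>2 \<le> 4 * norm x * norm (K x - M x) * \<bar>t\<bar>"
proof -
  interpret K: bounded_skew K by fact
  interpret M: bounded_skew M by fact
  let ?f = "\<lambda>t. flow K x t - flow M x t"
  have "\<bar>(norm (?f t))\<^sup>2 - (norm (?f 0))\<^sup>2\<bar> \<le> 4 * norm x * norm (K x - M x) * \<bar>t\<bar>"
  proof (rule norm_sq_diff_le)
    fix s
    show "(?f has_vector_derivative (K (flow K x s) - M (flow M x s))) (at s)"
      by (intro derivative_intros K.flow_deriv M.flow_deriv)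
    have "K (flow K x s) - M (flow M x s) = K (?f s) + flow M (K x - M x) s"
      by (simp add: K.diff M.flow_commute[OF K.bounded_linear comm] M.flow_diff
          M.flow_commute[OF M.bounded_linear])
    then have "Re (cinner (?f s) (K (flow K x s) - M (flow M x s)))
        = Re (cinner (?f s) (flow M (K x - M x) s))"
      using K.skew by (simp add: cinner_add_right)
    also have "\<bar>\<dots>\<bar> \<le> norm (?f s) * norm (K x - M x)"
      using abs_Re_cinner_le[of "?f s" "flow M (K x - M x) s"] by simp
    also have "\<dots> \<le> (2 * norm x) * norm (K x - M x)"
      using norm_triangle_ineq4[of "flow K x s" "flow M x s"] by (intro mult_right_mono) auto
    finally show "\<bar>2 * Re (cinner (?f s) (K (flow K x s) - M (flow M x s)))\<bar>
        \<le> 4 * norm x * norm (K x - M x)" by simp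
  qed
  then show ?thesis by simp
qed

section \<open>Unitary groups generated by maximal skew operators\<close>

lemma norm_triangle_add_diff: "norm (x + y - z) \<le> norm x + norm y + norm (z::'a::real_normed_vector)"
  using norm_triangle_ineq4[of "x + y" z] norm_triangle_ineq[of x y] by linarith

lemma unitary_operator_norm:
  assumes "unitary_operator V"
  shows "norm (V x) = norm x"
proof -
  have "(norm (V x))\<^sup>2 = (norm x)\<^sup>2"
    using assms unfolding unitary_operator_def Re_cinner_self[symmetric] by simp
  then show ?thesis by (simp add: power2_eq_iff_nonneg)
qed

lemma unitary_operator_bounded_linear:
  assumes "unitary_operator V"
  shows "bounded_linear V"
  using assms unitary_operator_norm[OF assms]
  unfolding unitary_operator_def linear_operator_def
  by (intro bounded_linear_intro[of _ 1]) (simp_all add: scaleR_scaleC)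

text \<open>Since \<open>V s\<close> is bounded and commutes with the group, the derivative at \<open>0\<close> of the orbit of
  \<open>V s x\<close> exists and is \<open>V s (L x)\<close>. By the definition of the generator, \<open>V s x\<close> lies in its
  domain.\<close>

lemma unitary_group_derivative:
  fixes V :: "real \<Rightarrow> 'h::complex_inner \<Rightarrow> 'h"
  assumes V: "unitary_group V" and gen: "generates D L V" and x: "x \<in> D"
  shows "V s x \<in> D" "L (V s x) = V s (L x)"
    "((\<lambda>s. V s x) has_vector_derivative L (V s x)) (at s)"
proof -
  have add: "V (s + r) = V s \<circ> V r" for s r using V by (simp add: unitary_group_def)
  have lin: "bounded_linear (V s)"
    using V by (simp add: unitary_group_def unitary_operator_bounded_linear)
  have "((\<lambda>h. V h x) has_vector_derivative L x) (at 0)"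
    using gen x by (simp add: generates_def)
  then have *: "((\<lambda>h. V s (V h x)) has_vector_derivative V s (L x)) (at 0)"
    by (rule bounded_linear.has_vector_derivative[OF lin])
  moreover have "V s (V h x) = V h (V s x)" for h
    using add[of s h] add[of h s] by (metis add.commute comp_apply)
  ultimately show D: "V s x \<in> D" and comm: "L (V s x) = V s (L x)"
    using gen by (simp_all add: generates_def)
  have "((\<lambda>r. r - s) has_vector_derivative 1) (at s)" by (auto intro!: derivative_eq_intros)
  then have "((\<lambda>h. V s (V h x)) \<circ> (\<lambda>r. r - s) has_vector_derivative 1 *\<^sub>R V s (L x)) (at s)"
    by (rule vector_diff_chain_at) (use * in simp)
  moreover have "V s (V (r - s) x) = V r x" for r using add[of s "r - s"] by simp
  ultimately show "((\<lambda>s. V s x) has_vector_derivative L (V s x)) (at s)"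
    by (simp add: o_def comm)
qed

text \<open>The hypothesis under which a unitary group is constructed: a densely defined skew operator
  for which every \<open>1 - r L\<close> with real \<open>r \<noteq> 0\<close> is onto. Skew-adjoint operators have this property,
  and it passes easily to relatively bounded perturbations.\<close>

locale maximal_skew =
  fixes D :: "'h::chilbert_space set" and L :: "'h \<Rightarrow> 'h"
  assumes linear_op: "linear_operator D L"
    and dense: "closure D = UNIV"
    and skew: "x \<in> D \<Longrightarrow> Re (cinner x (L x)) = 0"
    and range: "r \<noteq> 0 \<Longrightarrow> \<exists>x\<in>D. x - r *\<^sub>R L x = y"
begin

lemma D_add: "x \<in> D \<Longrightarrow> y \<in> D \<Longrightarrow> x + y \<in> D"
  and D_scaleC: "x \<in> D \<Longrightarrow> c *\<^sub>C x \<in> D"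
  and L_add: "x \<in> D \<Longrightarrow> y \<in> D \<Longrightarrow> L (x + y) = L x + L y"
  and L_scaleC: "x \<in> D \<Longrightarrow> L (c *\<^sub>C x) = c *\<^sub>C L x"
  using linear_op by (auto simp: linear_operator_def csubspace_def)

lemma D_scaleR: "x \<in> D \<Longrightarrow> r *\<^sub>R x \<in> D" and L_scaleR: "x \<in> D \<Longrightarrow> L (r *\<^sub>R x) = r *\<^sub>R L x"
  by (simp_all add: scaleR_scaleC D_scaleC L_scaleC)

lemma D_diff: "x \<in> D \<Longrightarrow> y \<in> D \<Longrightarrow> x - y \<in> D"
  and L_diff: "x \<in> D \<Longrightarrow> y \<in> D \<Longrightarrow> L (x - y) = L x - L y"
  using D_add[of x "- 1 *\<^sub>R y"] D_scaleR[of y "- 1"] L_add[of x "- 1 *\<^sub>R y"] L_scaleR[of y "- 1"]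
  by simp_all

lemma approx_in_D:
  assumes "e > 0"
  obtains y where "y \<in> D" "norm (x - y) < e"
proof -
  have "x \<in> closure D" by (simp add: dense)
  then show ?thesis
    using that assms unfolding closure_approachable by (metis dist_norm norm_minus_commute)
qed

lemma skew_pair: "x \<in> D \<Longrightarrow> y \<in> D \<Longrightarrow> Re (cinner (L x) y) = - Re (cinner x (L y))"
  using skew[of x] skew[of y] skew[OF D_add, of x y] Re_cinner_commute[of y "L x"]
  by (simp add: L_add cinner_add_left cinner_add_right)

lemma norm_one_minus_sq:
  "x \<in> D \<Longrightarrow> (norm (x - r *\<^sub>R L x))\<^sup>2 = (norm x)\<^sup>2 + (norm (r *\<^sub>R L x))\<^sup>2"
  unfolding norm_diff_sq by (simp add: cinner_scaleR_right skew)

text \<open>This is \<open>(1 - r L)\<^sup>-\<^sup>1\<close>, a rescaled resolvent of \<open>L\<close> at \<open>1 / r\<close>.\<close>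

definition resolvent :: "real \<Rightarrow> 'h \<Rightarrow> 'h" where
  "resolvent r y = (SOME x. x \<in> D \<and> x - r *\<^sub>R L x = y)"

context
  fixes r :: real
  assumes r: "r \<noteq> 0"
begin

lemma resolvent_mem: "resolvent r y \<in> D" and resolvent_eq: "resolvent r y
    - r *\<^sub>R L (resolvent r y) = y"
  using someI_ex[of "\<lambda>x. x \<in> D \<and> x - r *\<^sub>R L x
      = y"] range[OF r, of y] unfolding resolvent_def by blast+

lemma resolvent_expand: "r *\<^sub>R L (resolvent r y) = resolvent r y - y"
  by (metis resolvent_eq diff_diff_eq2 add_diff_cancel_left')

lemma resolvent_unique:
  assumes "x \<in> D" "x - r *\<^sub>R L x = y"
  shows "resolvent r y = x"
proof -
  let ?z = "resolvent r y - x"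
  have "?z - r *\<^sub>R L ?z = (resolvent r y - r *\<^sub>R L (resolvent r y)) - (x - r *\<^sub>R L x)"
    by (simp add: L_diff[OF resolvent_mem assms(1)] algebra_simps)
  then have "?z - r *\<^sub>R L ?z = 0" by (simp only: resolvent_eq assms(2) diff_self)
  then have "(norm ?z)\<^sup>2 + (norm (r *\<^sub>R L ?z))\<^sup>2 = 0"
    using norm_one_minus_sq[of ?z r] D_diff[OF resolvent_mem assms(1)] by simp
  then have "(norm ?z)\<^sup>2 = 0" by (simp add: add_nonneg_eq_0_iff)
  then show ?thesis by simp
qed

lemma resolvent_scaleC: "resolvent r (c *\<^sub>C y) = c *\<^sub>C resolvent r y"
proof (rule resolvent_unique)
  have "c *\<^sub>C resolvent r y - r *\<^sub>R L (c *\<^sub>C resolvent r y)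
      = c *\<^sub>C (resolvent r y - r *\<^sub>R L (resolvent r y))"
    by (simp add: L_scaleC[OF resolvent_mem]
        scaleC_diff_right scaleR_scaleC scaleC_scaleC mult.commute)
  then show "c *\<^sub>C resolvent r y - r *\<^sub>R L (c *\<^sub>C resolvent r y) = c *\<^sub>C y"
    by (simp add: resolvent_eq)
qed (intro D_scaleC resolvent_mem)

lemma resolvent_add: "resolvent r (x + y) = resolvent r x + resolvent r y"
proof (rule resolvent_unique)
  show "resolvent r x + resolvent r y - r *\<^sub>R L (resolvent r x + resolvent r y) = x + y"
    by (simp add: L_add[OF resolvent_mem resolvent_mem] scaleR_right_distrib resolvent_expand)
qed (intro D_add resolvent_mem)

lemma norm_resolvent_le: "norm (resolvent r y) \<le> norm y"
proof -
  have "(norm y)\<^sup>2 = (norm (resolvent r y))\<^sup>2 + (norm (r *\<^sub>R L (resolvent r y)))\<^sup>2"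
    using norm_one_minus_sq[OF resolvent_mem, of y r] by (simp add: resolvent_eq)
  then have "(norm (resolvent r y))\<^sup>2 \<le> (norm y)\<^sup>2" by simp
  then show ?thesis by (rule power2_le_imp_le) simp
qed

lemma bounded_linear_resolvent: "bounded_linear (resolvent r)"
  by (rule bounded_linear_intro[of _ 1]) (simp_all add: resolvent_add scaleR_scaleC
      resolvent_scaleC norm_resolvent_le)

lemma resolvent_diff: "resolvent r (x - y) = resolvent r x - resolvent r y"
  by (rule linear_diff[OF bounded_linear.linear[OF bounded_linear_resolvent]])

lemma resolvent_scaleR: "resolvent r (c *\<^sub>R x) = c *\<^sub>R resolvent r x"
  by (simp add: scaleR_scaleC resolvent_scaleC)

text \<open>The resolvent at \<open>r\<close> maps \<open>D\<close> into the domain of \<open>L\<^sup>2\<close>, so \<open>L\<close> can be applied to its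
  defining equation.\<close>

lemma L_resolvent:
  assumes x: "x \<in> D"
  shows "L (resolvent r x) = resolvent r (L x)"
proof -
  have "L (resolvent r x) = (1 / r) *\<^sub>R (resolvent r x - x)"
    unfolding resolvent_expand[symmetric] using r by simp
  then have LxD: "L (resolvent r x) \<in> D" by (simp add: D_scaleR D_diff resolvent_mem x)
  have "L (resolvent r x) - r *\<^sub>R L (L (resolvent r x)) = L x"
    using LxD x resolvent_mem[of x]
    by (simp add: L_scaleR[symmetric, OF LxD] resolvent_expand L_diff)
  with LxD show ?thesis by (intro resolvent_unique[symmetric])
qed

end

lemma resolvent_commute:
  assumes "r \<noteq> 0" "s \<noteq> 0"
  shows "resolvent r (resolvent s y) = resolvent s (resolvent r y)"
proof (rule resolvent_unique[OF assms(1)])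
  show "resolvent s (resolvent r y) - r *\<^sub>R L (resolvent s (resolvent r y)) = resolvent s y"
    by (simp only: L_resolvent[OF assms(2) resolvent_mem[OF assms(1)]]
        resolvent_scaleR[OF assms(2), symmetric]
        resolvent_diff[OF assms(2), symmetric] resolvent_eq[OF assms(1)])
qed (rule resolvent_mem[OF assms(2)])

text \<open>On \<open>D\<close> the distance between the resolvent and the identity is at most \<open>\<bar>r\<bar> \<parallel>L x\<parallel>\<close>; density
  and contractivity do the rest.\<close>

lemma resolvent_tendsto_id:
  assumes "e > 0"
  shows "\<exists>d>0. \<forall>r. r \<noteq> 0 \<longrightarrow> \<bar>r\<bar> < d \<longrightarrow> norm (resolvent r x - x) < e"
proof -
  obtain y where y: "y \<in> D" "norm (x - y) < e / 3"
    using approx_in_D[of "e / 3" x] assms by auto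
  define d where "d = (e / 3) / (norm (L y) + 1)"
  have pos: "norm (L y) + 1 > 0" by (simp add: add_nonneg_pos)
  have "norm (resolvent r x - x) < e" if r0: "r \<noteq> 0" and r: "\<bar>r\<bar> < d" for r
  proof -
    have "resolvent r y - y = r *\<^sub>R resolvent r (L y)"
      by (simp only: resolvent_expand[OF r0, symmetric] L_resolvent[OF r0 y(1)])
    then have "norm (resolvent r y - y) \<le> \<bar>r\<bar> * norm (L y)"
      by (simp add: norm_resolvent_le[OF r0] mult_left_mono)
    also have "\<dots> \<le> d * (norm (L y) + 1)" using r by (intro mult_mono) auto
    also have "\<dots> = e / 3" using pos unfolding d_def by (simp del: divide_divide_eq_left)
    finally have 1: "norm (resolvent r y - y) \<le> e / 3" .
    have "resolvent r x - x = resolvent r (x - y) + (resolvent r y - y) - (x - y)"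
      by (simp add: resolvent_diff[OF r0])
    then have "norm (resolvent r x - x) \<le> norm (resolvent r (x - y)) + norm (resolvent r y - y)
        + norm (x - y)"
      by (metis norm_triangle_add_diff)
    then show ?thesis using 1 y(2) norm_resolvent_le[OF r0, of "x - y"] by simp
  qed
  moreover have "d > 0" using assms pos by (simp add: d_def)
  ultimately show ?thesis by blast
qed

text \<open>The Yosida approximation in its antisymmetric form. It equals \<open>L (1 - r\<^sup>2 L\<^sup>2)\<^sup>-\<^sup>1\<close>, so it
  is a bounded operator that is skew like \<open>L\<close> and approximates \<open>L\<close> on \<open>D\<close> as \<open>r\<close> tends to \<open>0\<close>.\<close>

definition yosida :: "real \<Rightarrow> 'h \<Rightarrow> 'h" where
  "yosida r x = (1 / (2 * r)) *\<^sub>R (resolvent r x - resolvent (- r) x)"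

lemma bounded_skew_yosida:
  assumes r: "r \<noteq> 0"
  shows "bounded_skew (yosida r)"
proof (rule bounded_skew.intro)
  have r': "- r \<noteq> 0" using r by simp
  show "bounded_linear (yosida r)"
    unfolding yosida_def
    by (intro bounded_linear_scaleR_right[THEN bounded_linear_compose] bounded_linear_sub
        bounded_linear_resolvent[OF r] bounded_linear_resolvent[OF r'])
  fix x
  \<comment> \<open>Skewness of the approximation says that both resolvents have the same component along \<open>x\<close>;
    to see it, each occurrence of \<open>x\<close> is expressed through the other resolvent.\<close>
  let ?p = "resolvent r x" and ?q = "resolvent (- r) x"
  have "Re (cinner x ?p) = Re (cinner (?q - (- r) *\<^sub>R L ?q) ?p)" by (simp only: resolvent_eq[OF r'])
  also have "\<dots> = Re (cinner ?p ?q) - r * Re (cinner (L ?p) ?q)"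
    using skew_pair[OF resolvent_mem[OF r] resolvent_mem[OF r'], of x x] Re_cinner_commute[of ?p ?q]
      Re_cinner_commute[of ?p "L ?q"]
    by (simp add: cinner_add_left cinner_scaleR_left)
  also have "\<dots> = Re (cinner (?p - r *\<^sub>R L ?p) ?q)"
    by (simp add: cinner_diff_left cinner_scaleR_left)
  also have "\<dots> = Re (cinner x ?q)" by (simp only: resolvent_eq[OF r])
  finally show "Re (cinner x (yosida r x)) = 0"
    by (simp add: yosida_def cinner_scaleR_right cinner_diff_right)
qed

lemma yosida_scaleC: "r \<noteq> 0 \<Longrightarrow> yosida r (c *\<^sub>C x) = c *\<^sub>C yosida r x"
  by (simp add: yosida_def resolvent_scaleC scaleC_diff_right[symmetric]
      scaleR_scaleC scaleC_scaleC mult.commute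
      del: of_real_divide)

lemma yosida_commute: "r \<noteq> 0 \<Longrightarrow> s \<noteq> 0 \<Longrightarrow> yosida r (yosida s x) = yosida s (yosida r x)"
  by (simp add: yosida_def resolvent_scaleR resolvent_diff resolvent_commute[of r s]
      resolvent_commute[of r "- s"] resolvent_commute[of "- r" s] resolvent_commute[of "- r" "- s"]
          algebra_simps)

lemma yosida_on_D:
  assumes "x \<in> D" "r \<noteq> 0"
  shows "yosida r x = (1 / 2) *\<^sub>R (resolvent r (L x) + resolvent (- r) (L x))"
proof -
  have *: "resolvent s x = x + s *\<^sub>R resolvent s (L x)" if "s \<noteq> 0" for s
    by (simp add: L_resolvent[OF that assms(1), symmetric] resolvent_expand[OF that])
  have "resolvent r x - resolvent (- r) x = r *\<^sub>R (resolvent r (L x) + resolvent (- r) (L x))"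
    using *[of r] *[of "- r"] assms(2) by (simp add: algebra_simps)
  then show ?thesis using assms(2) by (simp add: yosida_def)
qed

lemma norm_yosida_le: "x \<in> D \<Longrightarrow> r \<noteq> 0 \<Longrightarrow> norm (yosida r x) \<le> norm (L x)"
  using norm_triangle_ineq[of "resolvent r (L x)" "resolvent (- r) (L x)"]
    norm_resolvent_le[of r "L x"] norm_resolvent_le[of "- r" "L x"]
  by (simp add: yosida_on_D)

definition yosida_seq :: "nat \<Rightarrow> 'h \<Rightarrow> 'h" where "yosida_seq n = yosida (inverse (real (Suc n)))"

lemma bounded_skew_yosida_seq: "bounded_skew (yosida_seq n)"
  by (simp add: yosida_seq_def bounded_skew_yosida)

lemma norm_yosida_seq_le: "x \<in> D \<Longrightarrow> norm (yosida_seq n x) \<le> norm (L x)"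
  unfolding yosida_seq_def by (rule norm_yosida_le) simp_all

lemma yosida_seq_tendsto:
  assumes x: "x \<in> D"
  shows "(\<lambda>n. yosida_seq n x) \<longlonglongrightarrow> L x"
proof (rule LIMSEQ_I)
  fix e :: real assume "e > 0"
  then obtain d where d: "d > 0" "\<And>r. r \<noteq> 0 \<Longrightarrow> \<bar>r\<bar> < d \<Longrightarrow> norm (resolvent r (L x) - L x) < e"
    using resolvent_tendsto_id[of e "L x"] by blast
  obtain N where N: "\<And>n. n \<ge> N \<Longrightarrow> norm (inverse (real (Suc n)) - 0) < d"
    using LIMSEQ_D[OF LIMSEQ_inverse_real_of_nat d(1)] by blast
  have "norm (yosida_seq n x - L x) < e" if n: "n \<ge> N" for n
  proof -
    let ?r = "inverse (real (Suc n))"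
    have r: "\<bar>?r\<bar> < d" "\<bar>- ?r\<bar> < d" using N[OF n] by simp_all
    have "yosida_seq n x - L x = (1 / 2) *\<^sub>R ((resolvent ?r (L x) - L x)
        + (resolvent (- ?r) (L x) - L x))"
      by (simp add: yosida_seq_def yosida_on_D[OF x] algebra_simps flip: scaleR_left_distrib)
    also have "norm \<dots> \<le> (norm (resolvent ?r (L x) - L x) + norm (resolvent (- ?r) (L x) - L x)) / 2"
      using norm_triangle_ineq[of "resolvent ?r (L x) - L x" "resolvent (- ?r) (L x) - L x"] by simp
    also have "\<dots> < e" using d(2)[OF _ r(1)] d(2)[OF _ r(2)] by simp
    finally show ?thesis .
  qed
  then show "\<exists>N. \<forall>n\<ge>N. norm (yosida_seq n x - L x) < e" by blast
qed

definition approx :: "nat \<Rightarrow> real \<Rightarrow> 'h \<Rightarrow> 'h" where "approx n t x = flow (yosida_seq n) x t"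

lemma approx_simps [simp]: "approx n 0 x = x" "norm (approx n t x) = norm x"
  and approx_add: "approx n t (x + y) = approx n t x + approx n t y"
  and approx_diff: "approx n t (x - y) = approx n t x - approx n t y"
  and approx_group: "approx n (s + t) x = approx n t (approx n s x)"
  and norm_approx_diff_le: "norm (approx n t x - x) \<le> norm (yosida_seq n x) * \<bar>t\<bar>"
proof -
  interpret bounded_skew "yosida_seq n" by (rule bounded_skew_yosida_seq)
  show "approx n 0 x = x" "norm (approx n t x) = norm x"
    "approx n t (x + y) = approx n t x + approx n t y"
    "approx n t (x - y) = approx n t x - approx n t y"
    "approx n (s + t) x = approx n t (approx n s x)"
    "norm (approx n t x - x) \<le> norm (yosida_seq n x) * \<bar>t\<bar>"
    by (simp_all add: approx_def flow_add flow_diff flow_group norm_flow_diff_le)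
qed

lemma approx_scaleC: "approx n t (c *\<^sub>C x) = c *\<^sub>C approx n t x"
  unfolding approx_def
  by (rule bounded_skew.flow_commute[OF bounded_skew_yosida_seq bounded_linear_scaleC, symmetric])
     (simp add: yosida_seq_def yosida_scaleC)

text \<open>Uniformity in \<open>n\<close> holds because the approximations of \<open>L y\<close> are bounded by \<open>\<parallel>L y\<parallel>\<close> for
  \<open>y \<in> D\<close>.\<close>

lemma approx_equicontinuous:
  assumes "e > 0"
  shows "\<exists>d>0. \<forall>s n. \<bar>s\<bar> < d \<longrightarrow> norm (approx n s x - x) \<le> e"
proof -
  obtain y where y: "y \<in> D" "norm (x - y) < e / 3"
    using approx_in_D[of "e / 3" x] assms by auto
  define d where "d = (e / 3) / (norm (L y) + 1)"
  have pos: "norm (L y) + 1 > 0" by (simp add: add_nonneg_pos)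
  have "norm (approx n s x - x) \<le> e" if s: "\<bar>s\<bar> < d" for s n
  proof -
    have "norm (approx n s y - y) \<le> norm (yosida_seq n y) * \<bar>s\<bar>" by (rule norm_approx_diff_le)
    also have "\<dots> \<le> (norm (L y) + 1) * d"
      using s norm_yosida_seq_le[OF y(1), of n] by (intro mult_mono) auto
    also have "\<dots> = e / 3" using pos unfolding d_def by (simp del: divide_divide_eq_left)
    finally have 1: "norm (approx n s y - y) \<le> e / 3" .
    have "approx n s x - x = approx n s (x - y) + (approx n s y - y) - (x - y)"
      by (simp add: approx_diff)
    then have "norm (approx n s x - x) \<le> norm (approx n s (x - y)) + norm (approx n s y - y)
        + norm (x - y)"
      by (metis norm_triangle_add_diff)
    then show ?thesis using 1 y(2) by simp
  qed
  moreover have "d > 0" using assms pos by (simp add: d_def)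
  ultimately show ?thesis by blast
qed

text \<open>For \<open>y \<in> D\<close> the Yosida approximations of \<open>L y\<close> converge and the corresponding flows can be
  compared; isometry extends the conclusion to the closure of \<open>D\<close>.\<close>

lemma approx_Cauchy: "Cauchy (\<lambda>n. approx n t x)"
proof (rule metric_CauchyI)
  fix e :: real assume e: "e > 0"
  obtain y where y: "y \<in> D" "norm (x - y) < e / 3"
    using approx_in_D[of "e / 3" x] e by auto
  define c where "c = 4 * norm y * \<bar>t\<bar> + 1"
  have c: "c > 0" by (simp add: c_def add_nonneg_pos)
  have "Cauchy (\<lambda>n. yosida_seq n y)" using yosida_seq_tendsto[OF y(1)] by (rule LIMSEQ_imp_Cauchy)
  moreover have "(e / 3)\<^sup>2 / c > 0" using e c by simp
  ultimately obtain N where N: "\<And>m n. m \<ge> N \<Longrightarrow> n \<ge> N \<Longrightarrow> dist (yosida_seq m y)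
      (yosida_seq n y) < (e / 3)\<^sup>2 / c"
    by (meson metric_CauchyD)
  have "dist (approx m t x) (approx n t x) < e" if mn: "m \<ge> N" "n \<ge> N" for m n
  proof -
    have "(norm (approx m t y - approx n t y))\<^sup>2
        \<le> 4 * norm y * norm (yosida_seq m y - yosida_seq n y) * \<bar>t\<bar>"
      unfolding approx_def by (rule flow_compare[OF bounded_skew_yosida_seq
          bounded_skew_yosida_seq]) (simp add: yosida_seq_def yosida_commute)
    also have "\<dots> \<le> c * norm (yosida_seq m y - yosida_seq n y)"
      by (simp add: c_def algebra_simps)
    also have "\<dots> \<le> (e / 3)\<^sup>2"
      using N[OF mn] c by (simp add: dist_norm field_simps)
    finally have "(norm (approx m t y - approx n t y))\<^sup>2 \<le> (e / 3)\<^sup>2" .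
    then have 1: "norm (approx m t y - approx n t y) \<le> e / 3"
      by (rule power2_le_imp_le) (use e in simp)
    have "approx m t x - approx n t x = approx m t (x - y)
        + (approx m t y - approx n t y) - approx n t (x - y)" by (simp add: approx_diff)
    then have "norm (approx m t x - approx n t x)
        \<le> norm (approx m t (x - y)) + norm (approx m t y - approx n t y) + norm (approx n t (x - y))"
      by (metis norm_triangle_add_diff)
    then show ?thesis using 1 y(2) by (simp add: dist_norm)
  qed
  then show "\<exists>M. \<forall>m\<ge>M. \<forall>n\<ge>M. dist (approx m t x) (approx n t x) < e" by blast
qed

definition evolution :: "real \<Rightarrow> 'h \<Rightarrow> 'h" where "evolution t x = lim (\<lambda>n. approx n t x)"

lemma approx_tendsto_evolution: "(\<lambda>n. approx n t x) \<longlonglongrightarrow> evolution t x"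
  unfolding evolution_def using approx_Cauchy Cauchy_convergent convergent_LIMSEQ_iff by blast

lemma evolution_0: "evolution 0 x = x"
proof (rule LIMSEQ_unique[OF approx_tendsto_evolution])
  show "(\<lambda>n. approx n 0 x) \<longlonglongrightarrow> x" by simp
qed

lemma norm_evolution: "norm (evolution t x) = norm x"
proof (rule LIMSEQ_unique[OF tendsto_norm[OF approx_tendsto_evolution]])
  show "(\<lambda>n. norm (approx n t x)) \<longlonglongrightarrow> norm x" by simp
qed

lemma evolution_add: "evolution t (x + y) = evolution t x + evolution t y"
proof (rule LIMSEQ_unique[OF approx_tendsto_evolution])
  show "(\<lambda>n. approx n t (x + y)) \<longlonglongrightarrow> evolution t x + evolution t y"
    unfolding approx_add by (intro tendsto_add approx_tendsto_evolution)
qed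

lemma evolution_scaleC: "evolution t (c *\<^sub>C x) = c *\<^sub>C evolution t x"
proof (rule LIMSEQ_unique[OF approx_tendsto_evolution])
  show "(\<lambda>n. approx n t (c *\<^sub>C x)) \<longlonglongrightarrow> c *\<^sub>C evolution t x"
    unfolding approx_scaleC by (intro bounded_linear.tendsto[OF bounded_linear_scaleC]
        approx_tendsto_evolution)
qed

lemma evolution_diff: "evolution t (x - y) = evolution t x - evolution t y"
proof (rule LIMSEQ_unique[OF approx_tendsto_evolution])
  show "(\<lambda>n. approx n t (x - y)) \<longlonglongrightarrow> evolution t x - evolution t y"
    unfolding approx_diff by (intro tendsto_diff approx_tendsto_evolution)
qed

lemma evolution_group: "evolution (s + t) x = evolution t (evolution s x)"
proof -
  have "(\<lambda>n. norm (approx n s x - evolution s x)) \<longlonglongrightarrow> 0"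
    using LIM_zero[OF approx_tendsto_evolution[of s x]] tendsto_norm_zero by blast
  then have "(\<lambda>n. norm (approx n t (approx n s x - evolution s x))) \<longlonglongrightarrow> 0" by simp
  then have "(\<lambda>n. approx n t (approx n s x - evolution s x)) \<longlonglongrightarrow> 0" by (rule tendsto_norm_zero_cancel)
  from tendsto_add[OF this approx_tendsto_evolution[of t "evolution s x"]]
  have "(\<lambda>n. approx n (s + t) x) \<longlonglongrightarrow> evolution t (evolution s x)"
    by (simp add: approx_group approx_diff)
  then show ?thesis by (rule LIMSEQ_unique[OF approx_tendsto_evolution])
qed

lemma evolution_continuous_at_0:
  assumes "e > 0"
  shows "\<exists>d>0. \<forall>s. \<bar>s\<bar> < d \<longrightarrow> norm (evolution s x - x) \<le> e"
proof -
  obtain d where d: "d > 0" "\<And>s n. \<bar>s\<bar> < d \<Longrightarrow> norm (approx n s x - x) \<le> e"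
    using approx_equicontinuous[OF assms] by blast
  have "norm (evolution s x - x) \<le> e" if "\<bar>s\<bar> < d" for s
    using d(2)[OF that]
    by (intro LIMSEQ_le_const2[OF tendsto_norm[OF tendsto_diff[OF approx_tendsto_evolution
        tendsto_const]]]) blast
  with d(1) show ?thesis by blast
qed

lemma evolution_continuous: "continuous_on UNIV (\<lambda>s. evolution s x)"
proof (rule continuous_onI)
  fix s e :: real assume "e > 0"
  then obtain d where d: "d > 0" "\<And>r. \<bar>r\<bar> < d \<Longrightarrow> norm (evolution r x - x) \<le> e"
    using evolution_continuous_at_0 by blast
  have "dist (evolution s' x) (evolution s x) \<le> e" if "dist s' s < d" for s'
  proof -
    have "evolution s' x = evolution s (evolution (s' - s) x)"
      using evolution_group[of "s' - s" s] by simp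
    then have "evolution s' x - evolution s x = evolution s (evolution (s' - s) x - x)"
      by (simp add: evolution_diff)
    then show ?thesis using d(2)[of "s' - s"] that by (simp add: dist_norm norm_evolution)
  qed
  with d(1) show "\<exists>d>0. \<forall>s'\<in>UNIV. dist s' s < d \<longrightarrow> dist (evolution s' x) (evolution s x) \<le> e" by blast
qed

lemma cinner_evolution: "cinner (evolution t x) (evolution t y) = cinner x y"
proof -
  have Re: "Re (cinner (evolution t x) (evolution t y)) = Re (cinner x y)" for x y
    using norm_add_sq[of "evolution t x" "evolution t y"] norm_add_sq[of x y]
      norm_evolution[of t x] norm_evolution[of t y]
      norm_evolution[of t "x + y"] by (simp add: evolution_add)
  show ?thesis
    using Re[of x y] Re[of x "\<i> *\<^sub>C y"] by (simp add: complex_eq_iff Im_cinner_eq evolution_scaleC)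
qed

lemma unitary_group_evolution: "unitary_group evolution"
  unfolding unitary_group_def unitary_operator_def linear_operator_def csubspace_def
proof (intro conjI allI)
  show "surj (evolution s)" for s
    using evolution_group[of "- s" s] evolution_0 by (metis add.left_inverse surjI)
  show "evolution 0 = id" using evolution_0 by auto
  show "evolution (s + r) = evolution s \<circ> evolution r" for s r
    using evolution_group[of r s] by (auto simp: add.commute)
qed (auto simp: cinner_evolution evolution_add evolution_scaleC evolution_continuous)

text \<open>The first order expansions of the approximating flows have a remainder that is small
  uniformly in all large \<open>n\<close>, by equicontinuity at \<open>L x\<close>.\<close>

lemma evolution_derivative:
  assumes x: "x \<in> D"
  shows "((\<lambda>s. evolution s x) has_vector_derivative L x) (at 0)"
  unfolding has_vector_derivative_def has_derivative_within_alt
proof (intro conjI allI impI)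
  show "bounded_linear (\<lambda>r. r *\<^sub>R L x)" by (rule bounded_linear_scaleR_left)
  fix e :: real assume e: "e > 0"
  obtain d where d: "d > 0" "\<And>s n. \<bar>s\<bar> < d \<Longrightarrow> norm (approx n s (L x) - L x) \<le> e"
    using approx_equicontinuous[OF e] by blast
  have "norm (evolution t x - evolution 0 x - (t - 0) *\<^sub>R L x)
      \<le> e * norm (t - 0)" if t: "norm (t - 0) < d" for t
  proof -
    have "norm (approx n t x - x - t *\<^sub>R yosida_seq n x)
        \<le> (e + 2 * norm (yosida_seq n x - L x)) * \<bar>t\<bar>" for n
      unfolding approx_def
    proof (rule bounded_skew.norm_flow_taylor_le[OF bounded_skew_yosida_seq])
      fix s assume "\<bar>s\<bar> \<le> \<bar>t\<bar>"
      then have "norm (approx n s (L x) - L x) \<le> e" using t by (intro d(2)) simp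
      moreover have "approx n s (yosida_seq n x) - yosida_seq n x
          = approx n s (yosida_seq n x - L x) + (approx n s (L x) - L x) - (yosida_seq n x - L x)"
        by (simp add: approx_diff)
      then have "norm (approx n s (yosida_seq n x) - yosida_seq n x)
          \<le> norm (approx n s (yosida_seq n x - L x)) + norm (approx n s (L x) - L x)
              + norm (yosida_seq n x - L x)"
        by (metis norm_triangle_add_diff)
      ultimately show "norm (flow (yosida_seq n) (yosida_seq n x) s - yosida_seq n x)
          \<le> e + 2 * norm (yosida_seq n x - L x)"
        unfolding approx_def[symmetric] by simp
    qed
    moreover have "(\<lambda>n. norm (approx n t x - x - t *\<^sub>R yosida_seq n x)) \<longlonglongrightarrow> norm (evolution t x - x
        - t *\<^sub>R L x)"
      by (intro tendsto_intros approx_tendsto_evolution yosida_seq_tendsto x)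
    moreover have "(\<lambda>n. (e + 2 * norm (yosida_seq n x - L x)) * \<bar>t\<bar>) \<longlonglongrightarrow> (e
        + 2 * norm (L x - L x)) * \<bar>t\<bar>"
      by (intro tendsto_intros yosida_seq_tendsto x)
    ultimately have "norm (evolution t x - x - t *\<^sub>R L x) \<le> (e + 2 * norm (L x - L x)) * \<bar>t\<bar>"
      by (intro LIMSEQ_le) auto
    then show ?thesis by (simp add: evolution_0)
  qed
  with d(1) show "\<exists>d>0. \<forall>y\<in>UNIV. norm (y - 0) < d \<longrightarrow>
      norm (evolution y x - evolution 0 x - (y - 0) *\<^sub>R L x) \<le> e * norm (y - 0)" by blast
qed

text \<open>The generator cannot be larger than \<open>L\<close>: it is skew because the group is isometric, and for
  its restriction \<open>L\<close> the operator \<open>1 - L\<close> is already onto. If \<open>z\<close> is the derivative at \<open>x\<close>, then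
  \<open>x - z = y - L y\<close> for some \<open>y \<in> D\<close>, so \<open>w = x - y\<close> is its own derivative, which is impossible
  for an orbit of constant norm unless \<open>w = 0\<close>.\<close>

lemma generates_evolution: "generates D L evolution"
  unfolding generates_def
proof (intro allI iffI)
  fix x z assume d: "((\<lambda>s. evolution s x) has_vector_derivative z) (at 0)"
  obtain y where y: "y \<in> D" "y - L y = x - z" using range[of 1 "x - z"] by auto
  let ?w = "x - y"
  have w: "z - L y = ?w" using y(2) by (simp add: algebra_simps)
  have "((\<lambda>s. evolution s ?w) has_vector_derivative ?w) (at 0)"
    using has_vector_derivative_diff[OF d evolution_derivative[OF y(1)]]
        by (simp add: evolution_diff w)
  from has_real_derivative_norm_sq[OF this]
  have "((\<lambda>s. (norm ?w)\<^sup>2) has_real_derivative 2 * (norm ?w)\<^sup>2) (at 0)"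
    by (simp add: norm_evolution evolution_0 Re_cinner_self)
  then have "2 * (norm ?w)\<^sup>2 = 0" by (rule DERIV_unique) simp
  then have "x = y" by simp
  with d y show "x \<in> D \<and> z = L x" by auto
qed (use evolution_derivative in auto)

text \<open>Two groups with the same generator agree on \<open>D\<close> by the energy method, hence everywhere.\<close>

lemma group_exp_eq_evolution: "group_exp D L = evolution"
  unfolding group_exp_def
proof (rule the_equality)
  show "unitary_group evolution \<and> generates D L evolution"
    by (simp add: unitary_group_evolution generates_evolution)
  fix V assume "unitary_group V \<and> generates D L V"
  then have V: "unitary_group V" and gen: "generates D L V" by auto
  have nV: "norm (V t x) = norm x" and dV: "V t (x - y) = V t x - V t y" for t x y
  proof -
    have u: "unitary_operator (V t)" using V by (simp add: unitary_group_def)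
    then show "norm (V t x) = norm x" by (rule unitary_operator_norm)
    show "V t (x - y) = V t x - V t y"
      by (rule linear_diff[OF bounded_linear.linear[OF unitary_operator_bounded_linear[OF u]]])
  qed
  have on_D: "V t y = evolution t y" if y: "y \<in> D" for t y
  proof -
    note dv = unitary_group_derivative[OF V gen y]
    note du = unitary_group_derivative[OF unitary_group_evolution generates_evolution y]
    have "\<bar>(norm (V t y - evolution t y))\<^sup>2 - (norm (V 0 y - evolution 0 y))\<^sup>2\<bar> \<le> 0 * \<bar>t\<bar>"
    proof (rule norm_sq_diff_le)
      show "((\<lambda>t. V t y - evolution t y) has_vector_derivative (L (V s y) - L (evolution s y)))
          (at s)" for s
        by (intro derivative_intros dv du)
      show "\<bar>2 * Re (cinner (V s y - evolution s y) (L (V s y) - L (evolution s y)))\<bar> \<le> 0" for s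
        using skew[OF D_diff[OF dv(1) du(1)]] by (simp add: L_diff[OF dv(1) du(1)])
    qed
    moreover have "V 0 y = y" using V by (simp add: unitary_group_def)
    ultimately show ?thesis by (simp add: evolution_0)
  qed
  show "V = evolution"
  proof (intro ext)
    fix t x
    have "norm (V t x - evolution t x) \<le> 0 + e" if "e > 0" for e
    proof -
      obtain y where y: "y \<in> D" "norm (x - y) < e / 2"
        using approx_in_D[of "e / 2" x] \<open>e > 0\<close> by auto
      have "V t x - evolution t x = V t (x - y) - evolution t (x - y)"
        by (simp add: dV evolution_diff on_D[OF y(1)])
      then have "norm (V t x - evolution t x) \<le> norm (V t (x - y)) + norm (evolution t (x - y))"
        by (metis norm_triangle_ineq4)
      then show ?thesis using y(2) by (simp add: nV norm_evolution)
    qed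
    then have "norm (V t x - evolution t x) \<le> 0" by (rule field_le_epsilon)
    then show "V t x = evolution t x" by simp
  qed
qed

end

section \<open>Skew-adjoint operators and their perturbations\<close>

lemma adjoint_graph_memI:
  assumes lin: "linear_operator D A" and "\<And>\<psi>. \<psi> \<in> D \<Longrightarrow> Re (cinner x (A \<psi>)) = Re (cinner y \<psi>)"
  shows "(x, y) \<in> adjoint_graph D A"
proof -
  have "cinner x (A \<psi>) = cinner y \<psi>" if \<psi>: "\<psi> \<in> D" for \<psi>
  proof -
    have "\<i> *\<^sub>C \<psi> \<in> D" "A (\<i> *\<^sub>C \<psi>) = \<i> *\<^sub>C A \<psi>"
      using lin \<psi> by (auto simp: linear_operator_def csubspace_def)
    then show ?thesis
      using assms(2)[OF \<psi>] assms(2)[of "\<i> *\<^sub>C \<psi>"] by (simp add: complex_eq_iff Im_cinner_eq)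
  qed
  then show ?thesis by (simp add: adjoint_graph_def)
qed

text \<open>By skewness \<open>\<parallel>x - r A x\<parallel>\<^sup>2 = \<parallel>x\<parallel>\<^sup>2 + \<parallel>r A x\<parallel>\<^sup>2\<close>, and \<open>A\<close> is closed as the negative of an
  adjoint, so the range of \<open>1 - r A\<close> is closed. A vector \<open>z\<close> orthogonal to the range satisfies
  \<open>- A z = z / r\<close> by the definition of the adjoint, and skewness of \<open>A\<close> forces \<open>z = 0\<close>.\<close>

lemma skew_adjoint_imp_maximal_skew:
  fixes D :: "'h::chilbert_space set"
  assumes "skew_adjoint D A"
  shows "maximal_skew D A"
proof
  have graph: "adjoint_graph D A = (\<lambda>\<phi>. (\<phi>, - A \<phi>)) ` D"
    using assms by (simp add: skew_adjoint_def)
  show lin: "linear_operator D A" and "closure D = UNIV"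
    using assms by (simp_all add: skew_adjoint_def densely_defined_operator_def)
  have D: "0 \<in> D" "\<And>x y. x \<in> D \<Longrightarrow> y \<in> D \<Longrightarrow> x + y \<in> D" "\<And>c x. x \<in> D \<Longrightarrow> c *\<^sub>R x \<in> D"
    and A: "\<And>x y. x \<in> D \<Longrightarrow> y \<in> D \<Longrightarrow> A (x + y) = A x + A y" "\<And>c x. x \<in> D \<Longrightarrow> A (c *\<^sub>R x) = c *\<^sub>R A x"
    using lin by (simp_all add: linear_operator_def csubspace_def scaleR_scaleC)
  have A_diff: "x - y \<in> D" "A (x - y) = A x - A y" if "x \<in> D" "y \<in> D" for x y
    using D(2)[OF that(1) D(3)[OF that(2), of "-1"]] A(1)[OF that(1) D(3)[OF that(2), of "-1"]]
        A(2)[OF that(2), of "-1"]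
    by simp_all
  have sym: "cinner \<phi> (A \<psi>) = cinner (- A \<phi>) \<psi>" if "\<phi> \<in> D" "\<psi> \<in> D" for \<phi> \<psi>
  proof -
    have "(\<phi>, - A \<phi>) \<in> adjoint_graph D A" using that graph by auto
    then show ?thesis using that by (simp add: adjoint_graph_def)
  qed
  show skew: "Re (cinner x (A x)) = 0" if "x \<in> D" for x
    using arg_cong[OF sym[OF that that], of Re] Re_cinner_commute[of "A x" x] by simp
  have norm_eq: "(norm (x - r *\<^sub>R A x))\<^sup>2 = (norm x)\<^sup>2 + (norm (r *\<^sub>R A x))\<^sup>2" if "x \<in> D" for x r
    unfolding norm_diff_sq by (simp add: cinner_scaleR_right skew that)
  have range: "(\<lambda>x. x - r *\<^sub>R A x) ` D = UNIV" if r: "r \<noteq> 0" for r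
  proof (rule ccontr)
    let ?M = "(\<lambda>x. x - r *\<^sub>R A x) ` D"
    assume "?M \<noteq> UNIV"
    moreover have "subspace ?M"
    proof (rule subspaceI)
      show "0 \<in> ?M" using D(1) A(2)[OF D(1), of 0] by (intro image_eqI[where x = 0]) auto
    next
      fix p q assume "p \<in> ?M" "q \<in> ?M"
      then obtain x y where xy: "x \<in> D" "y \<in> D" and pq: "p = x - r *\<^sub>R A x" "q
          = y - r *\<^sub>R A y" by blast
      have "p + q = (x + y) - r *\<^sub>R A (x + y)"
        unfolding pq A(1)[OF xy] by (simp add: algebra_simps)
      then show "p + q \<in> ?M" using D(2)[OF xy] by blast
    next
      fix c p assume "p \<in> ?M"
      then obtain x where x: "x \<in> D" and p: "p = x - r *\<^sub>R A x" by blast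
      have "c *\<^sub>R p = (c *\<^sub>R x) - r *\<^sub>R A (c *\<^sub>R x)"
        unfolding p A(2)[OF x] by (simp add: algebra_simps)
      then show "c *\<^sub>R p \<in> ?M" using D(3)[OF x] by blast
    qed
    moreover have "closed ?M"
    proof (rule closed_sequential_limits[THEN iffD2], intro allI impI)
      fix q l assume "(\<forall>n. q n \<in> ?M) \<and> q \<longlonglongrightarrow> l"
      then have q: "\<And>n. q n \<in> ?M" and l: "q \<longlonglongrightarrow> l" by auto
      then obtain x where xD: "\<And>n. x n \<in> D" and x: "\<And>n. q n = x n - r *\<^sub>R A (x n)"
        unfolding image_iff by metis
      have "Cauchy x"
      proof (rule metric_CauchyI)
        fix e :: real assume "e > 0"
        then obtain N where N: "\<And>m n. m \<ge> N \<Longrightarrow> n \<ge> N \<Longrightarrow> dist (q m) (q n) < e"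
          using metric_CauchyD[OF LIMSEQ_imp_Cauchy[OF l]] by blast
        have "dist (x m) (x n) \<le> dist (q m) (q n)" for m n
        proof -
          have "q m - q n = (x m - x n) - r *\<^sub>R A (x m - x n)"
            by (simp add: x A_diff(2)[OF xD xD] algebra_simps)
          then have "(norm (x m - x n))\<^sup>2 \<le> (norm (q m - q n))\<^sup>2"
            using norm_eq[OF A_diff(1)[OF xD xD], of m n r] by simp
          then show ?thesis unfolding dist_norm by (rule power2_le_imp_le) simp
        qed
        then show "\<exists>M. \<forall>m\<ge>M. \<forall>n\<ge>M. dist (x m) (x n) < e" using N by (meson le_less_trans)
      qed
      then obtain x0 where x0: "x \<longlonglongrightarrow> x0" using Cauchy_convergent convergent_def by blast
      have "(\<lambda>n. (1 / r) *\<^sub>R (x n - q n)) \<longlonglongrightarrow> (1 / r) *\<^sub>R (x0 - l)"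
        by (intro tendsto_intros x0 l)
      then have Ax: "(\<lambda>n. A (x n)) \<longlonglongrightarrow> (1 / r) *\<^sub>R (x0 - l)" by (simp add: x r)
      have "(x0, - ((1 / r) *\<^sub>R (x0 - l))) \<in> adjoint_graph D A"
      proof (rule adjoint_graph_memI[OF lin])
        fix \<psi> assume \<psi>: "\<psi> \<in> D"
        have "(\<lambda>n. Re (cinner (x n) (A \<psi>))) \<longlonglongrightarrow> Re (cinner x0 (A \<psi>))"
          by (rule bounded_bilinear.tendsto[OF bounded_bilinear_Re_cinner x0 tendsto_const])
        moreover have "(\<lambda>n. Re (cinner (- A (x n)) \<psi>)) \<longlonglongrightarrow> Re (cinner (- ((1 / r) *\<^sub>R (x0 - l))) \<psi>)"
          by (rule bounded_bilinear.tendsto[OF bounded_bilinear_Re_cinner tendsto_minus[OF Ax]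
              tendsto_const])
        ultimately show "Re (cinner x0 (A \<psi>)) = Re (cinner (- ((1 / r) *\<^sub>R (x0 - l))) \<psi>)"
          using sym[OF xD \<psi>] by (simp add: LIMSEQ_unique)
      qed
      then have "x0 \<in> D" "A x0 = (1 / r) *\<^sub>R (x0 - l)" using graph by auto
      then show "l \<in> ?M" using r by (intro image_eqI[where x = x0]) auto
    qed
    ultimately obtain z where z: "z \<noteq> 0" "\<And>x. x \<in> D \<Longrightarrow> Re (cinner z (x - r *\<^sub>R A x)) = 0"
      using orthogonal_complement_nontrivial[of ?M] by blast
    have "(z, (1 / r) *\<^sub>R z) \<in> adjoint_graph D A"
    proof (rule adjoint_graph_memI[OF lin])
      fix x assume "x \<in> D"
      from z(2)[OF this] show "Re (cinner z (A x)) = Re (cinner ((1 / r) *\<^sub>R z) x)"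
        using r by (simp add: cinner_diff_right cinner_scaleR_right cinner_scaleR_left field_simps)
    qed
    then have "z \<in> D" "- A z = (1 / r) *\<^sub>R z" using graph by auto
    then have "Re (cinner z ((1 / r) *\<^sub>R z)) = 0" using skew[of z] by (simp flip: \<open>- A z = _\<close>)
    then show False using r z(1) by (simp add: cinner_scaleR_right Re_cinner_self)
  qed
  show "\<exists>x\<in>D. x - r *\<^sub>R A x = y" if "r \<noteq> 0" for r y
  proof -
    have "y \<in> (\<lambda>x. x - r *\<^sub>R A x) ` D" unfolding range[OF that] by simp
    then show ?thesis by blast
  qed
qed

lemma skew_symmetricD:
  assumes "skew_symmetric D B" "x \<in> D"
  shows "Re (cinner x (B x)) = 0" "y \<in> D \<Longrightarrow> x - y \<in> D \<and> B (x - y) = B x - B y"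
proof -
  have "cinner (B x) x = - cinner x (B x)" using assms by (simp add: skew_symmetric_def)
  then show "Re (cinner x (B x)) = 0" using Re_cinner_commute[of "B x" x] by simp
  assume y: "y \<in> D"
  have lin: "linear_operator D B"
    using assms by (simp add: skew_symmetric_def densely_defined_operator_def)
  have *: "- 1 *\<^sub>R y \<in> D" "B (- 1 *\<^sub>R y) = - 1 *\<^sub>R B y"
    unfolding scaleR_scaleC using lin y by (auto simp: linear_operator_def csubspace_def)
  then have "x + - 1 *\<^sub>R y \<in> D \<and> B (x + - 1 *\<^sub>R y) = B x + - 1 *\<^sub>R B y"
    using lin assms(2) by (simp only: linear_operator_def csubspace_def)
  then show "x - y \<in> D \<and> B (x - y) = B x - B y" by simp
qed

text \<open>With \<open>w = x - r A x\<close> as the unknown, the equation \<open>x - r (A + v B) x = y\<close> becomes a fixed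
  point problem for \<open>w \<mapsto> y + r v B (1 - r A)\<^sup>-\<^sup>1 w\<close>. This map is a contraction with constant
  \<open>\<bar>v\<bar> a < 1\<close>, since \<open>r A (1 - r A)\<^sup>-\<^sup>1\<close> has norm at most \<open>1\<close>.\<close>

lemma kato_rellich:
  fixes D :: "'h::chilbert_space set"
  assumes "maximal_skew D A" and B: "skew_symmetric DB B" and "D \<subseteq> DB"
    and B_le: "\<And>x. x \<in> D \<Longrightarrow> norm (B x) \<le> a * norm (A x)" and v: "\<bar>v\<bar> * a < 1" and "0 \<le> a"
  shows "maximal_skew D (\<lambda>x. A x + v *\<^sub>R B x)"
proof
  interpret A: maximal_skew D A by fact
  have B_lin: "linear_operator DB B"
    using B by (simp add: skew_symmetric_def densely_defined_operator_def)
  have B_add: "B (x + y) = B x + B y" and B_scaleC: "B (c *\<^sub>C x) = c *\<^sub>C B x"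
    and B_diff: "B (x - y) = B x - B y" if "x \<in> D" "y \<in> D" for x y c
  proof -
    have "x \<in> DB" "y \<in> DB" using that \<open>D \<subseteq> DB\<close> by auto
    then show "B (x + y) = B x + B y" "B (c *\<^sub>C x) = c *\<^sub>C B x" "B (x - y) = B x - B y"
      using B_lin skew_symmetricD(2)[OF B] by (simp_all add: linear_operator_def)
  qed
  show "linear_operator D (\<lambda>x. A x + v *\<^sub>R B x)"
    using A.linear_op unfolding linear_operator_def
    by (simp add: A.L_add B_add A.L_scaleC B_scaleC scaleC_add_right scaleR_scaleC scaleC_scaleC
        scaleC_add_left algebra_simps)
  show "closure D = UNIV" by (rule A.dense)
  show "Re (cinner x (A x + v *\<^sub>R B x)) = 0" if "x \<in> D" for x
    using A.skew[OF that] skew_symmetricD(1)[OF B, of x] that \<open>D \<subseteq> DB\<close>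
    by (auto simp: cinner_add_right cinner_scaleR_right)
  show "\<exists>x\<in>D. x - r *\<^sub>R (A x + v *\<^sub>R B x) = y" if r: "r \<noteq> 0" for r y
  proof -
    define F where "F w = y + (r * v) *\<^sub>R B (A.resolvent r w)" for w
    have "\<exists>!w. F w = w"
    proof (rule banach_fix_type[where c = "\<bar>v\<bar> * a"])
      show "\<forall>w w'. dist (F w) (F w') \<le> \<bar>v\<bar> * a * dist w w'"
      proof (intro allI)
        fix w w'
        let ?x = "A.resolvent r (w - w')"
        have "F w - F w' = (r * v) *\<^sub>R B ?x"
          by (simp add: F_def A.resolvent_diff[OF r] B_diff[OF A.resolvent_mem[OF r]
              A.resolvent_mem[OF r]] scaleR_diff_right)
        then have "dist (F w) (F w') = \<bar>v\<bar> * (\<bar>r\<bar> * norm (B ?x))"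
          by (simp add: dist_norm abs_mult)
        also have "\<dots> \<le> \<bar>v\<bar> * (\<bar>r\<bar> * (a * norm (A ?x)))"
          by (intro mult_left_mono B_le A.resolvent_mem r) auto
        also have "\<dots> = \<bar>v\<bar> * a * norm (r *\<^sub>R A ?x)" by simp
        also have "\<dots> \<le> \<bar>v\<bar> * a * norm (w - w')"
        proof (rule mult_left_mono)
          have "(norm (r *\<^sub>R A ?x))\<^sup>2 \<le> (norm (w - w'))\<^sup>2"
            using A.norm_one_minus_sq[OF A.resolvent_mem[OF r], of "w - w'" r]
                by (simp add: A.resolvent_eq[OF r])
          then show "norm (r *\<^sub>R A ?x) \<le> norm (w - w')" by (rule power2_le_imp_le) simp
        qed (use \<open>0 \<le> a\<close> in simp)
        finally show "dist (F w) (F w') \<le> \<bar>v\<bar> * a * dist w w'" by (simp add: dist_norm)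
      qed
    qed (use v \<open>0 \<le> a\<close> in auto)
    then obtain w where "F w = w" by blast
    then have "w - (r * v) *\<^sub>R B (A.resolvent r w) = y" by (simp add: F_def diff_eq_eq)
    moreover have "A.resolvent r w - r *\<^sub>R A (A.resolvent r w) = w" by (rule A.resolvent_eq[OF r])
    ultimately have "A.resolvent r w - r *\<^sub>R A (A.resolvent r w) - (r * v) *\<^sub>R B (A.resolvent r w)
        = y" by simp
    then have "A.resolvent r w - r *\<^sub>R (A (A.resolvent r w) + v *\<^sub>R B (A.resolvent r w)) = y"
      by (simp add: scaleR_add_right diff_diff_eq)
    then show ?thesis using A.resolvent_mem[OF r] by blast
  qed
qed

section \<open>Trajectories of piecewise constant controls\<close>

text \<open>A gap between \<open>Sup I\<close> and \<open>Inf Q\<close> would contain a point missing from the interval \<open>I \<union> Q\<close>.\<close>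

lemma interval_union_split:
  fixes I Q :: "real set"
  assumes "I \<noteq> {}" "Q \<noteq> {}" and lt: "\<And>x y. x \<in> I \<Longrightarrow> y \<in> Q \<Longrightarrow> x < y"
    and int: "is_interval (I \<union> Q)" and bdd: "bounded (I \<union> Q)"
  shows "is_interval Q" "Sup I = Inf Q" "Inf (I \<union> Q) = Inf I" "Sup (I \<union> Q) = Sup Q"
proof -
  have b: "bdd_above I" "bdd_below I" "bdd_above Q" "bdd_below Q"
    using bdd by (auto simp: bounded_imp_bdd_above bounded_imp_bdd_below)
  have int': "x \<in> I \<union> Q" if "y \<in> I \<union> Q" "z \<in> I \<union> Q" "y \<le> x" "x \<le> z" for x y z
    using int that unfolding is_interval_1 by blast
  show "is_interval Q"
    unfolding is_interval_1
  proof (intro ballI allI impI)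
    fix y z x assume "y \<in> Q" "z \<in> Q" "y \<le> x \<and> x \<le> z"
    then show "x \<in> Q" using int'[of y z x] lt[of x y] by force
  qed
  obtain x0 y0 where x0: "x0 \<in> I" and y0: "y0 \<in> Q" using assms(1,2) by blast
  have le: "Sup I \<le> Inf Q"
    using lt by (intro cInf_greatest cSup_least assms) (auto intro: less_imp_le)
  moreover have "\<not> Sup I < Inf Q"
  proof
    assume "Sup I < Inf Q"
    then obtain m where m: "Sup I < m" "m < Inf Q" using dense by blast
    have "x0 \<le> m" "m \<le> y0"
      using m cSup_upper[OF x0 b(1)] cInf_lower[OF y0 b(4)] by linarith+
    then have "m \<in> I \<union> Q" using int' x0 y0 by blast
    then show False using m cSup_upper[OF _ b(1), of m] cInf_lower[OF _ b(4), of m] by fastforce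
  qed
  ultimately show "Sup I = Inf Q" by linarith
  have "Inf I \<le> Sup I" "Inf Q \<le> Sup Q"
    using assms(1,2) b by (auto intro: cInf_le_cSup)
  then show "Inf (I \<union> Q) = Inf I" "Sup (I \<union> Q) = Sup Q"
    using le b assms(1,2) by (simp_all add: cInf_union_distrib cSup_union_distrib inf_absorb1
        sup_absorb2)
qed

lemma interior_of_interval:
  fixes I :: "real set"
  assumes "is_interval I" "I \<noteq> {}" "Inf I < s" "s < Sup I"
  shows "s \<in> I"
proof -
  obtain x where "x \<in> I" "x < s" using cInf_lessD[OF assms(2,3)] by blast
  moreover obtain y where "y \<in> I" "s < y" using less_cSupD[OF assms(2,4)] by blast
  ultimately show ?thesis using assms(1) unfolding is_interval_1 by (meson less_imp_le)
qed

fun jumps :: "real list \<Rightarrow> real" where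
  "jumps (x # y # zs) = \<bar>y - x\<bar> + jumps (y # zs)"
| "jumps _ = 0"

lemma jumps_Cons: "xs \<noteq> [] \<Longrightarrow> jumps (x # xs) = \<bar>hd xs - x\<bar> + jumps xs"
  by (cases xs) auto

text \<open>The bounds \<open>\<bar>v\<bar> a \<le> 1 - \<delta>\<close> on control values are stated where they are used; they make every
  \<open>A + v B\<close> the generator of a unitary group on the common domain \<open>DA\<close>.\<close>

locale bilinear_system =
  fixes DA DB :: "'h::chilbert_space set" and A B :: "'h \<Rightarrow> 'h" and a \<delta> :: real
  assumes A_maximal: "maximal_skew DA A"
    and B_skew: "skew_symmetric DB B"
    and DA_subset: "DA \<subseteq> DB"
    and B_le: "\<psi> \<in> DA \<Longrightarrow> norm (B \<psi>) \<le> a * norm (A \<psi>)"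
    and a_pos: "0 < a" and \<delta>_pos: "0 < \<delta>"
begin

sublocale A: maximal_skew DA A by (rule A_maximal)

lemma generator:
  assumes "\<bar>v\<bar> * a \<le> 1 - \<delta>"
  shows "unitary_group (control_exp DA A DB B v)"
    "generates DA (\<lambda>\<psi>. A \<psi> + v *\<^sub>R B \<psi>) (control_exp DA A DB B v)"
proof -
  have "\<bar>v\<bar> * a < 1" using assms \<delta>_pos by linarith
  then interpret L: maximal_skew DA "\<lambda>\<psi>. A \<psi> + v *\<^sub>R B \<psi>"
    using kato_rellich[OF A_maximal B_skew DA_subset B_le] a_pos by simp
  have "control_exp DA A DB B v = L.evolution"
    unfolding control_exp_def Int_absorb2[OF DA_subset] by (rule L.group_exp_eq_evolution)
  then show "unitary_group (control_exp DA A DB B v)"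
    "generates DA (\<lambda>\<psi>. A \<psi> + v *\<^sub>R B \<psi>) (control_exp DA A DB B v)"
    by (simp_all add: L.unitary_group_evolution L.generates_evolution)
qed

text \<open>The margin \<open>\<delta>\<close> leaves a lower bound in terms of \<open>A\<close> alone that is uniform in the control
  value.\<close>

lemma coercive:
  assumes "\<bar>v\<bar> * a \<le> 1 - \<delta>" "\<psi> \<in> DA"
  shows "\<delta> * norm (A \<psi>) \<le> norm (A \<psi> + v *\<^sub>R B \<psi>)"
proof -
  have "norm (v *\<^sub>R B \<psi>) \<le> \<bar>v\<bar> * (a * norm (A \<psi>))"
    using B_le[OF assms(2)] by (simp add: mult_left_mono)
  also have "\<dots> \<le> (1 - \<delta>) * norm (A \<psi>)"
    using mult_right_mono[OF assms(1) norm_ge_zero[of "A \<psi>"]] by (simp add: mult.assoc)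
  finally show ?thesis
    using norm_triangle_ineq4[of "A \<psi> + v *\<^sub>R B \<psi>" "v *\<^sub>R B \<psi>"] by (simp add: algebra_simps)
qed

text \<open>Continuous curves in \<open>DA\<close> that solve the controlled equation away from finitely many
  switching times. The constant \<open>C\<close> bounds \<open>\<delta> \<parallel>A (f s)\<parallel>\<close>, in the form that coercivity yields
  directly.\<close>

definition trajectory :: "(real \<Rightarrow> real) \<Rightarrow> real \<Rightarrow> real \<Rightarrow> real \<Rightarrow> (real \<Rightarrow> 'h) \<Rightarrow> bool" where
  "trajectory u c d C f \<longleftrightarrow> c \<le> d \<and> continuous_on {c..d} f \<and>
     (\<exists>S. finite S \<and> (\<forall>s\<in>{c<..<d} - S. (f has_vector_derivative (A (f s)
         + u s *\<^sub>R B (f s))) (at s))) \<and>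
     (\<forall>s\<in>{c..d}. f s \<in> DA \<and> norm (f s) = norm (f c) \<and> \<delta> * norm (A (f s)) \<le> C)"

lemma trajectory_mono: "trajectory u c d C f \<Longrightarrow> C \<le> C' \<Longrightarrow> trajectory u c d C' f"
  unfolding trajectory_def by fastforce

text \<open>On an interval of constancy the group commutes with its generator, so \<open>\<parallel>(A + v B) f\<parallel>\<close> is
  conserved.\<close>

lemma trajectory_const:
  assumes v: "\<bar>v\<bar> * a \<le> 1 - \<delta>" and \<psi>: "\<psi> \<in> DA" and "c \<le> d" and u: "\<And>s. c < s \<Longrightarrow> s < d \<Longrightarrow> u s = v"
  shows "trajectory u c d (norm (A \<psi> + v *\<^sub>R B \<psi>)) (\<lambda>s. control_exp DA A DB B v (s - c) \<psi>)"
proof -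
  let ?V = "control_exp DA A DB B v"
  note V = generator[OF v]
  note dV = unitary_group_derivative[OF V \<psi>]
  have nV: "norm (?V s x) = norm x" for s x
    using V(1) by (intro unitary_operator_norm) (simp add: unitary_group_def)
  have deriv: "((\<lambda>s. ?V (s - c) \<psi>) has_vector_derivative
      (A (?V (s - c) \<psi>) + v *\<^sub>R B (?V (s - c) \<psi>))) (at s)" for s
  proof -
    have "((\<lambda>s. s - c) has_vector_derivative 1) (at s)" by (auto intro!: derivative_eq_intros)
    from vector_diff_chain_at[OF this dV(3)] show ?thesis by (simp add: o_def)
  qed
  have "continuous_on {c..d} (\<lambda>s. ?V (s - c) \<psi>)"
    by (rule continuous_on_vector_derivative[OF has_vector_derivative_at_within[OF deriv]])
  moreover have "\<delta> * norm (A (?V s \<psi>)) \<le> norm (A \<psi> + v *\<^sub>R B \<psi>)" for s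
    using coercive[OF v dV(1)[of s]] by (simp add: dV(2) nV)
  ultimately show ?thesis
    unfolding trajectory_def using \<open>c \<le> d\<close> dV(1) deriv u nV by (auto intro!: exI[of _ "{}"])
qed

lemma trajectory_join:
  assumes f: "trajectory u c d C f" and g: "trajectory u d e C g" and fg: "f d = g d"
  shows "trajectory u c e C (\<lambda>s. if s \<le> d then f s else g s)"
proof -
  let ?h = "\<lambda>s. if s \<le> d then f s else g s"
  obtain S where S: "finite S"
    "\<And>s. s \<in> {c<..<d} - S \<Longrightarrow> (f has_vector_derivative (A (f s) + u s *\<^sub>R B (f s))) (at s)"
    using f unfolding trajectory_def by blast
  obtain S' where S': "finite S'"
    "\<And>s. s \<in> {d<..<e} - S' \<Longrightarrow> (g has_vector_derivative (A (g s) + u s *\<^sub>R B (g s))) (at s)"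
    using g unfolding trajectory_def by blast
  have cd: "c \<le> d" "d \<le> e" using f g by (auto simp: trajectory_def)
  have "continuous_on ({c..d} \<union> {d..e}) ?h"
    using f g fg by (intro continuous_on_cases) (auto simp: trajectory_def)
  moreover have "{c..d} \<union> {d..e} = {c..e}" using cd by auto
  ultimately have cont: "continuous_on {c..e} ?h" by simp
  have deriv: "(?h has_vector_derivative (A (?h s) + u s *\<^sub>R B (?h s))) (at s)"
    if s: "s \<in> {c<..<e} - (S \<union> S' \<union> {d})" for s
  proof (cases "s < d")
    case True
    then have "s \<in> {c<..<d} - S" using s by auto
    from S(2)[OF this] have "(?h has_vector_derivative (A (f s) + u s *\<^sub>R B (f s))) (at s)"
      by (rule has_vector_derivative_transform_within_open[where S = "{..<d}"]) (use True in auto)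
    then show ?thesis using True by simp
  next
    case False
    then have "s \<in> {d<..<e} - S'" "s > d" using s by auto
    from S'(2)[OF this(1)] have "(?h has_vector_derivative (A (g s) + u s *\<^sub>R B (g s))) (at s)"
      by (rule has_vector_derivative_transform_within_open[where S = "{d<..}"]) (use \<open>s > d\<close> in auto)
    then show ?thesis using \<open>s > d\<close> by simp
  qed
  have fin: "finite (S \<union> S' \<union> {d})" using S S' by simp
  have bnd: "\<forall>s\<in>{c..e}. ?h s \<in> DA \<and> norm (?h s) = norm (?h c) \<and> \<delta> * norm (A (?h s)) \<le> C"
  proof
    fix s assume s: "s \<in> {c..e}"
    have F: "f r \<in> DA \<and> norm (f r) = norm (f c) \<and> \<delta> * norm (A (f r)) \<le> C" if "r \<in> {c..d}" for r
      using f that unfolding trajectory_def by blast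
    have G: "g r \<in> DA \<and> norm (g r) = norm (g d) \<and> \<delta> * norm (A (g r)) \<le> C" if "r \<in> {d..e}" for r
      using g that unfolding trajectory_def by blast
    have "norm (g d) = norm (f c)" using F[of d] cd fg by simp
    then show "?h s \<in> DA \<and> norm (?h s) = norm (?h c) \<and> \<delta> * norm (A (?h s)) \<le> C"
      using F[of s] G[of s] s cd by simp
  qed
  show ?thesis unfolding trajectory_def
    using cd cont fin deriv bnd by (intro conjI exI[of _ "S \<union> S' \<union> {d}"] ballI) simp_all
qed

text \<open>The norm \<open>\<parallel>(A + v B) f\<parallel>\<close> is conserved while the control has the value \<open>v\<close>. A switch from \<open>v\<close>
  to \<open>w\<close> adds at most \<open>\<bar>w - v\<bar> \<parallel>B f\<parallel>\<close>, so it multiplies the norm by at most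
  \<open>1 + a \<bar>w - v\<bar> / \<delta> \<le> exp (a \<bar>w - v\<bar> / \<delta>)\<close>. The product of these factors depends only on the sum
  of the jumps.\<close>

lemma steps_trajectory:
  assumes "\<forall>(v, I)\<in>set ps. is_interval I \<and> I \<noteq> {} \<and> (\<forall>r\<in>I. u r = v) \<and> \<bar>v\<bar> * a \<le> 1 - \<delta>"
    and "sorted_wrt (\<lambda>(_, I) (_, J). \<forall>x\<in>I. \<forall>y\<in>J. x < y) ps"
    and "ps \<noteq> []" and "P = (\<Union>(v, I)\<in>set ps. I)" and "is_interval P" and "bounded P" and "\<psi> \<in> DA"
  shows "\<exists>f. trajectory u (Inf P) (Sup P)
      (exp (a / \<delta> * jumps (map fst ps)) * norm (A \<psi> + hd (map fst ps) *\<^sub>R B \<psi>)) f \<and>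
    f (Inf P) = \<psi> \<and> f (Sup P) = steps_propagator DA A DB B ps \<psi> \<and> u integrable_on {Inf P..Sup P}"
  using assms
proof (induction ps arbitrary: P \<psi>)
  case (Cons p qs)
  obtain v I where p: "p = (v, I)" by force
  have I: "is_interval I" "I \<noteq> {}" "\<And>r. r \<in> I \<Longrightarrow> u r = v" "\<bar>v\<bar> * a \<le> 1 - \<delta>"
    using Cons.prems(1) by (auto simp: p)
  have "I \<subseteq> P" using Cons.prems(4) by (auto simp: p)
  then have "bounded I" using Cons.prems(6) bounded_subset by blast
  then have le: "Inf I \<le> Sup I"
    using I(2) by (intro cInf_le_cSup bounded_imp_bdd_above bounded_imp_bdd_below)
  let ?V = "control_exp DA A DB B v"
  let ?f = "\<lambda>s. ?V (s - Inf I) \<psi>"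
  let ?N = "norm (A \<psi> + v *\<^sub>R B \<psi>)"
  have u_v: "u s = v" if "Inf I < s" "s < Sup I" for s
    using interior_of_interval[OF I(1,2) that] I(3) by blast
  have f: "trajectory u (Inf I) (Sup I) ?N ?f"
    by (rule trajectory_const[OF I(4) Cons.prems(7) le u_v])
  have f0: "?f (Inf I) = \<psi>" using generator(1)[OF I(4)] by (simp add: unitary_group_def)
  have "u integrable_on cbox (Inf I) (Sup I)"
    by (rule integrable_spike_interior[where f = "\<lambda>_. v"]) (auto intro: u_v)
  then have int: "u integrable_on {Inf I..Sup I}" by simp
  show ?case
  proof (cases "qs = []")
    case True
    then have "P = I" using Cons.prems(4) by (simp add: p)
    then show ?thesis
      using f f0 int True by (intro exI[of _ ?f]) (simp add: p steps_propagator_def)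
  next
    case False
    define Q where "Q = (\<Union>(v, I)\<in>set qs. I)"
    have P: "P = I \<union> Q" using Cons.prems(4) by (simp add: p Q_def)
    have "Q \<noteq> {}" using False Cons.prems(1) by (cases qs) (auto simp: Q_def)
    moreover have "x < y" if "x \<in> I" "y \<in> Q" for x y
      using that Cons.prems(2) by (auto simp: p Q_def)
    ultimately have split: "is_interval Q" "Sup I = Inf Q" "Inf P = Inf I" "Sup P = Sup Q"
      using interval_union_split[OF I(2), of Q] Cons.prems(5,6) unfolding P by blast+
    let ?\<phi> = "?V (Sup I - Inf I) \<psi>"
    let ?w = "hd (map fst qs)"
    note dV = unitary_group_derivative[OF generator[OF I(4)] Cons.prems(7), of "Sup I - Inf I"]
    have "bounded Q" using Cons.prems(6) by (simp add: P)
    then obtain g where g: "trajectory u (Inf Q) (Sup Q)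
        (exp (a / \<delta> * jumps (map fst qs)) * norm (A ?\<phi> + ?w *\<^sub>R B ?\<phi>)) g"
      "g (Inf Q) = ?\<phi>" "g (Sup Q) = steps_propagator DA A DB B qs ?\<phi>" "u integrable_on {Inf Q..Sup Q}"
      using Cons.IH[of Q ?\<phi>] Cons.prems(1,2) False Q_def split(1) dV(1) by auto
    have N: "norm (A ?\<phi> + v *\<^sub>R B ?\<phi>) = ?N"
      using generator(1)[OF I(4)] unfolding dV(2)
      by (intro unitary_operator_norm) (simp add: unitary_group_def)
    have "norm (A ?\<phi>) \<le> ?N / \<delta>"
      using coercive[OF I(4) dV(1)] \<delta>_pos by (simp add: N field_simps)
    then have B: "norm (B ?\<phi>) \<le> a / \<delta> * ?N"
      using B_le[OF dV(1)] mult_left_mono[of "norm (A ?\<phi>)" "?N / \<delta>" a] a_pos by simp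
    have eq: "A ?\<phi> + ?w *\<^sub>R B ?\<phi> = (A ?\<phi> + v *\<^sub>R B ?\<phi>) + (?w - v) *\<^sub>R B ?\<phi>"
      by (simp add: scaleR_left_diff_distrib)
    have "norm (A ?\<phi> + ?w *\<^sub>R B ?\<phi>) \<le> ?N + \<bar>?w - v\<bar> * norm (B ?\<phi>)"
      using norm_triangle_ineq[of "A ?\<phi> + v *\<^sub>R B ?\<phi>" "(?w - v) *\<^sub>R B ?\<phi>"]
      unfolding eq N norm_scaleR real_norm_def .
    also have "\<dots> \<le> ?N + \<bar>?w - v\<bar> * (a / \<delta> * ?N)"
      by (intro add_left_mono mult_left_mono B abs_ge_zero)
    also have "\<dots> = (1 + a / \<delta> * \<bar>?w - v\<bar>) * ?N" by (simp add: algebra_simps)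
    also have "\<dots> \<le> exp (a / \<delta> * \<bar>?w - v\<bar>) * ?N" by (intro mult_right_mono exp_ge_add_one_self) simp
    finally have step: "norm (A ?\<phi> + ?w *\<^sub>R B ?\<phi>) \<le> exp (a / \<delta> * \<bar>?w - v\<bar>) * ?N" .
    let ?C = "exp (a / \<delta> * jumps (map fst (p # qs))) * ?N"
    have jumps_eq: "jumps (map fst (p # qs)) = \<bar>?w - v\<bar> + jumps (map fst qs)"
      using False by (simp add: p jumps_Cons)
    have "exp (a / \<delta> * jumps (map fst qs)) * norm (A ?\<phi> + ?w *\<^sub>R B ?\<phi>)
        \<le> exp (a / \<delta> * jumps (map fst qs)) * (exp (a / \<delta> * \<bar>?w - v\<bar>) * ?N)"
      by (intro mult_left_mono step) simp
    also have "\<dots> = ?C" unfolding jumps_eq by (simp add: distrib_left exp_add)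
    finally have g': "trajectory u (Inf Q) (Sup Q) ?C g" by (rule trajectory_mono[OF g(1)])
    have "0 \<le> jumps xs" for xs by (induction xs rule: jumps.induct) auto
    then have "1 \<le> exp (a / \<delta> * jumps (map fst (p # qs)))"
      using a_pos \<delta>_pos by simp
    then have "?N \<le> ?C" using mult_right_mono[of 1 _ ?N] by fastforce
    then have f': "trajectory u (Inf I) (Inf Q) ?C ?f" using trajectory_mono[OF f] split(2) by simp
    let ?h = "\<lambda>s. if s \<le> Inf Q then ?f s else g s"
    have "trajectory u (Inf P) (Sup P) ?C ?h"
      unfolding split(3,4) by (rule trajectory_join[OF f' g']) (simp add: g(2) split(2))
    moreover have "?h (Inf P) = \<psi>" using le f0 by (simp add: split(2,3)[symmetric])
    moreover have "?h (Sup P) = steps_propagator DA A DB B (p # qs) \<psi>"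
    proof -
      have "Inf Q \<le> Sup Q" using g' by (simp add: trajectory_def)
      then have "?h (Sup Q) = g (Sup Q)" using g(2) split(2) by auto
      also have "\<dots> = steps_propagator DA A DB B (p # qs) \<psi>"
        by (simp add: g(3) p steps_propagator_def)
      finally show ?thesis unfolding split(4) .
    qed
    moreover have "u integrable_on {Inf P..Sup P}"
      unfolding split(3,4)
    proof (rule Henstock_Kurzweil_Integration.integrable_combine)
      show "Inf I \<le> Inf Q" "Inf Q \<le> Sup Q"
        using f' g' by (simp_all add: trajectory_def)
      show "u integrable_on {Inf I..Inf Q}" using int split(2) by simp
    qed (rule g(4))
    moreover have "hd (map fst (p # qs)) = v" by (simp add: p)
    ultimately show ?thesis by (intro exI[of _ ?h] conjI) (simp_all only:)
  qed
qed simp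

text \<open>For \<open>h = f - g\<close> the derivative of \<open>\<parallel>h\<parallel>\<^sup>2\<close> is \<open>2 Re \<langle>h, (A + u B) h + (u - w) B g\<rangle>\<close>. The
  first part vanishes as \<open>A + u B\<close> is skew, and \<open>\<parallel>B g\<parallel>\<close> is bounded along the trajectory, so
  integration compares the end points in terms of the \<open>L\<^sup>1\<close> distance of the controls.\<close>

lemma trajectory_diff:
  assumes f: "trajectory u 0 t C f" and g: "trajectory w 0 t C g" and "f 0 = \<psi>" "g 0 = \<psi>"
    and int: "(\<lambda>s. \<bar>u s - w s\<bar>) integrable_on {0..t}"
  shows "(norm (f t - g t))\<^sup>2 \<le> (4 * norm \<psi> * (a * C / \<delta>)) * integral {0..t} (\<lambda>s. \<bar>u s - w s\<bar>)"
proof -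
  have t: "0 \<le> t" using f by (simp add: trajectory_def)
  have F: "f s \<in> DA" "norm (f s) = norm \<psi>" if "s \<in> {0..t}" for s
    using f that \<open>f 0 = \<psi>\<close> by (auto simp: trajectory_def)
  have G: "g s \<in> DA" "norm (g s) = norm \<psi>" "\<delta> * norm (A (g s)) \<le> C" if "s \<in> {0..t}" for s
    using g that \<open>g 0 = \<psi>\<close> by (auto simp: trajectory_def)
  obtain S where S: "finite S"
    "\<And>s. s \<in> {0<..<t} - S \<Longrightarrow> (f has_vector_derivative (A (f s) + u s *\<^sub>R B (f s))) (at s)"
    using f unfolding trajectory_def by blast
  obtain S' where S': "finite S'"
    "\<And>s. s \<in> {0<..<t} - S' \<Longrightarrow> (g has_vector_derivative (A (g s) + w s *\<^sub>R B (g s))) (at s)"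
    using g unfolding trajectory_def by blast
  define h where "h s = f s - g s" for s
  define D where "D s = 2 * Re (cinner (h s) ((u s - w s) *\<^sub>R B (g s)))" for s
  have "(D has_integral ((norm (h t))\<^sup>2 - (norm (h 0))\<^sup>2)) {0..t}"
  proof (rule fundamental_theorem_of_calculus_interior_strong[where S = "S \<union> S'"])
    show "finite (S \<union> S')" using S S' by simp
    show "continuous_on {0..t} (\<lambda>s. (norm (h s))\<^sup>2)"
      unfolding h_def using f g by (intro continuous_intros) (simp_all add: trajectory_def)
    fix s assume s: "s \<in> {0<..<t} - (S \<union> S')"
    then have DA: "f s \<in> DA" "g s \<in> DA" using F(1) G(1) by auto
    have h: "h s \<in> DA" "A (h s) = A (f s) - A (g s)" "B (h s) = B (f s) - B (g s)"
      "Re (cinner (h s) (B (h s))) = 0"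
      using A.D_diff[OF DA] A.L_diff[OF DA] skew_symmetricD[OF B_skew] DA DA_subset
      by (auto simp: h_def)
    have "(h has_vector_derivative
        ((A (f s) + u s *\<^sub>R B (f s)) - (A (g s) + w s *\<^sub>R B (g s)))) (at s)"
      unfolding h_def using s by (intro derivative_intros S(2) S'(2)) auto
    also have "(A (f s) + u s *\<^sub>R B (f s)) - (A (g s) + w s *\<^sub>R B (g s))
        = A (h s) + u s *\<^sub>R B (h s) + (u s - w s) *\<^sub>R B (g s)"
      by (simp add: h(2,3) algebra_simps)
    finally have "((\<lambda>s. (norm (h s))\<^sup>2) has_real_derivative
        2 * Re (cinner (h s) (A (h s) + u s *\<^sub>R B (h s) + (u s - w s) *\<^sub>R B (g s)))) (at s)"
      by (rule has_real_derivative_norm_sq)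
    moreover have "2 * Re (cinner (h s) (A (h s) + u s *\<^sub>R B (h s) + (u s - w s) *\<^sub>R B (g s))) = D s"
      using A.skew[OF h(1)] h(4) by (simp add: D_def cinner_add_right cinner_scaleR_right)
    ultimately show "((\<lambda>s. (norm (h s))\<^sup>2) has_vector_derivative D s) (at s)"
      by (simp add: has_real_derivative_iff_has_vector_derivative)
  qed (rule t)
  moreover have "h 0 = 0" using assms by (simp add: h_def)
  ultimately have D_int: "(D has_integral (norm (h t))\<^sup>2) {0..t}" by simp
  have D_le: "D s \<le> (4 * norm \<psi> * (a * C / \<delta>)) * \<bar>u s - w s\<bar>" if s: "s \<in> {0..t}" for s
  proof -
    have "norm (B (g s)) \<le> a * norm (A (g s))" by (rule B_le[OF G(1)[OF s]])
    also have "norm (A (g s)) \<le> C / \<delta>" using G(3)[OF s] \<delta>_pos by (simp add: field_simps)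
    finally have B: "norm (B (g s)) \<le> a * C / \<delta>" using a_pos by (simp add: mult_left_mono)
    have h: "norm (h s) \<le> 2 * norm \<psi>"
      using norm_triangle_ineq4[of "f s" "g s"] F(2)[OF s] G(2)[OF s] by (simp add: h_def)
    have "D s \<le> 2 * (norm (h s) * (\<bar>u s - w s\<bar> * norm (B (g s))))"
      using Re_cinner_le[of "h s" "(u s - w s) *\<^sub>R B (g s)"] by (simp add: D_def)
    also have "\<dots> \<le> 2 * ((2 * norm \<psi>) * (\<bar>u s - w s\<bar> * (a * C / \<delta>)))"
      by (intro mult_left_mono mult_mono h B order_refl mult_nonneg_nonneg) auto
    finally show ?thesis by (simp add: algebra_simps)
  qed
  have "((\<lambda>s. (4 * norm \<psi> * (a * C / \<delta>)) * \<bar>u s - w s\<bar>) has_integral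
      (4 * norm \<psi> * (a * C / \<delta>)) * integral {0..t} (\<lambda>s. \<bar>u s - w s\<bar>)) {0..t}"
    by (intro has_integral_mult_right integrable_integral int)
  from has_integral_le[OF D_int this D_le] show ?thesis by (simp add: h_def)
qed

end

section \<open>Variation of piecewise constant controls\<close>

lemma jumps_eq_sum: "jumps (map u xs) = (\<Sum>k<length xs - 1. \<bar>u (xs ! Suc k) - u (xs ! k)\<bar>)"
proof (induction xs rule: induct_list012)
  case (3 x y zs)
  have "(\<Sum>k<Suc (length zs). \<bar>u ((x # y # zs) ! Suc k) - u ((x # y # zs) ! k)\<bar>)
      = \<bar>u y - u x\<bar> + (\<Sum>k<length zs. \<bar>u ((y # zs) ! Suc k) - u ((y # zs) ! k)\<bar>)"
    by (subst sum.lessThan_Suc_shift) simp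
  with 3 show ?case by simp
qed simp_all

lemma jumps_le_Cons: "jumps xs \<le> jumps (x # xs)"
  by (cases xs) auto

lemma jumps_le_snoc: "jumps xs \<le> jumps (xs @ [x])"
  by (induction xs rule: jumps.induct) auto

text \<open>Adding the end points \<open>0\<close> and \<open>T\<close> where they are missing turns the points \<open>xs\<close> into a
  partition and can only increase the sum of the jumps.\<close>

lemma jumps_le_variation:
  assumes V: "\<And>n \<sigma>. partition_of 0 T n \<sigma> \<Longrightarrow> variation_sum u n \<sigma> \<le> M"
    and xs: "sorted_wrt (<) xs" "set xs \<subseteq> {0..T}" "xs \<noteq> []"
  shows "jumps (map u xs) \<le> M"
proof -
  define ys where "ys = (if hd xs = 0 then xs else 0 # xs)"
  have ys: "sorted_wrt (<) ys" "set ys \<subseteq> {0..T}" "ys \<noteq> []" "hd ys = 0"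
    "jumps (map u xs) \<le> jumps (map u ys)"
  proof -
    obtain x xs' where x: "xs = x # xs'" using xs(3) by (cases xs) auto
    show "sorted_wrt (<) ys" using xs unfolding ys_def x by force
    show "set ys \<subseteq> {0..T}" "ys \<noteq> []" "hd ys = 0" using xs unfolding ys_def x by auto
    show "jumps (map u xs) \<le> jumps (map u ys)" using jumps_le_Cons by (auto simp: ys_def)
  qed
  define zs where "zs = (if last ys = T then ys else ys @ [T])"
  have zs: "sorted_wrt (<) zs" "zs \<noteq> []" "hd zs = 0" "last zs = T"
    "jumps (map u ys) \<le> jumps (map u zs)"
  proof -
    have "y < T" if "y \<in> set ys" "last ys \<noteq> T" for y
    proof -
      have "last ys \<in> {0..T}" using ys(2,3) last_in_set by blast
      then have "last ys < T" using that(2) by auto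
      moreover have "y \<le> last ys"
      proof -
        have "ys = butlast ys @ [last ys]" using ys(3) by simp
        then have "sorted_wrt (<) (butlast ys @ [last ys])" "y \<in> set (butlast ys @ [last ys])"
          using ys(1) that(1) by simp_all
        then show ?thesis unfolding sorted_wrt_append by fastforce
      qed
      ultimately show ?thesis by simp
    qed
    then show "sorted_wrt (<) zs" using ys(1) by (auto simp: zs_def sorted_wrt_append)
    show "zs \<noteq> []" "hd zs = 0" "last zs = T" using ys(3,4) by (auto simp: zs_def)
    show "jumps (map u ys) \<le> jumps (map u zs)" using jumps_le_snoc by (auto simp: zs_def)
  qed
  have "partition_of 0 T (length zs - 1) ((!) zs)"
    unfolding partition_of_def
    using zs(2-4) sorted_wrt_nth_less[OF zs(1)] by (auto simp: hd_conv_nth last_conv_nth)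
  then have "jumps (map u zs) \<le> M" using V unfolding jumps_eq_sum variation_sum_def by blast
  then show ?thesis using ys(5) zs(5) by linarith
qed

text \<open>One sample point from each interval of constancy realises all jumps.\<close>

lemma steps_jumps_le_variation:
  assumes V: "\<And>n \<sigma>. partition_of 0 T n \<sigma> \<Longrightarrow> variation_sum u n \<sigma> \<le> M"
    and "steps u t ps" "0 \<le> t" "t \<le> T"
  shows "jumps (map fst ps) \<le> M"
proof -
  have ps: "\<And>v I. (v, I) \<in> set ps \<Longrightarrow> I \<noteq> {} \<and> (\<forall>r\<in>I. u r = v)"
    "sorted_wrt (\<lambda>(_, I) (_, J). \<forall>x\<in>I. \<forall>y\<in>J. x < y) ps" "(\<Union>(v, I)\<in>set ps. I) = {0..t}"
    using assms(2) unfolding steps_def by auto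
  define pt where "pt p = (SOME x. x \<in> snd p)" for p :: "real \<times> real set"
  have pt: "pt p \<in> snd p" "u (pt p) = fst p" if "p \<in> set ps" for p
  proof -
    have "\<exists>x. x \<in> snd p" using ps(1)[of "fst p" "snd p"] that by auto
    then show *: "pt p \<in> snd p" unfolding pt_def by (rule someI_ex)
    then show "u (pt p) = fst p" using ps(1)[of "fst p" "snd p"] that by auto
  qed
  have "sorted_wrt (<) (map pt ps)"
    unfolding sorted_wrt_map
    by (rule sorted_wrt_mono_rel[OF _ ps(2)]) (use pt in fastforce)
  moreover have "set (map pt ps) \<subseteq> {0..T}"
  proof -
    have "pt p \<in> {0..t}" if "p \<in> set ps" for p
      using pt(1)[OF that] ps(3) that by (auto simp: case_prod_beta)
    then show ?thesis using assms(4) by fastforce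
  qed
  moreover have "map pt ps \<noteq> []" using ps(3) assms(3) by auto
  ultimately have "jumps (map u (map pt ps)) \<le> M"
    using jumps_le_variation[OF V] by blast
  moreover have "map u (map pt ps) = map fst ps" using pt(2) by simp
  ultimately show ?thesis by (simp only:)
qed

text \<open>Intersecting with \<open>{..t}\<close> may empty some of the intervals, which a list of steps does not
  admit.\<close>

lemma steps_restrict:
  assumes "steps u T ps" "t \<le> T"
  shows "\<exists>qs. steps u t qs"
proof
  let ?g = "\<lambda>(v, I). (v :: real, I \<inter> {..t})"
  let ?qs = "filter (\<lambda>(v, I). I \<noteq> {}) (map ?g ps)"
  have "sorted_wrt (\<lambda>(_, I) (_, J). \<forall>x\<in>I. \<forall>y\<in>J. x < y) (map ?g ps)"
    unfolding sorted_wrt_map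
    by (rule sorted_wrt_mono_rel[where P = "\<lambda>(_, I) (_, J). \<forall>x\<in>I. \<forall>y\<in>J. x < y"])
       (use assms(1) in \<open>auto simp: steps_def\<close>)
  then have "sorted_wrt (\<lambda>(_, I) (_, J). \<forall>x\<in>I. \<forall>y\<in>J. x < y) ?qs"
    by (rule sorted_wrt_filter)
  moreover have "(\<Union>(v, I)\<in>set ?qs. I) = (\<Union>(v, I)\<in>set ps. I) \<inter> {..t}"
    by auto
  then have "(\<Union>(v, I)\<in>set ?qs. I) = {0..t}"
    using assms unfolding steps_def by auto
  moreover have "\<forall>(v, I)\<in>set ?qs. is_interval I \<and> I \<noteq> {} \<and> (\<forall>r\<in>I. u r = v)"
    using assms(1) unfolding steps_def by (auto intro!: is_interval_Int is_interval_ic)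
  ultimately show "steps u t ?qs" unfolding steps_def by blast
qed

section \<open>Convergence of the propagators\<close>

theorem proposition4:
  fixes DA DB :: "'h::chilbert_space set" and A B :: "'h \<Rightarrow> 'h"
    and a \<delta> T t :: real and u :: "real \<Rightarrow> real" and un :: "nat \<Rightarrow> real \<Rightarrow> real" and \<psi> :: 'h
  assumes "separable_space (euclidean :: 'h topology)"
    and "a > 0"
    and "skew_adjoint DA A"
    and "bounded_from_below DA (\<lambda>\<psi>. \<i> *\<^sub>C A \<psi>)"
    and "skew_symmetric DB B"
    and "DA \<subseteq> DB"
    and "\<forall>\<psi>\<in>DA. norm (B \<psi>) \<le> a * norm (A \<psi>)"
    and "0 < \<delta>" and "\<delta> < 1"
    and "T > 0"
    and "u \<in> admissible_controls \<delta> a"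
    and "\<forall>n. un n \<in> admissible_controls \<delta> a"
    and "\<forall>n. piecewise_constant (un n) T"
    and "\<forall>s. (\<lambda>n. un n s) \<longlonglongrightarrow> u s"
    and "\<forall>n. total_variation 0 T (un n) \<le> total_variation 0 T u"
    and "t \<in> {0..T}"
    and "\<psi> \<in> DA"
  shows "Cauchy (\<lambda>n. propagator DA A DB B (un n) t \<psi>)"
proof -
  interpret bilinear_system DA DB A B a \<delta>
    using assms(2,5-8) skew_adjoint_imp_maximal_skew[OF assms(3)] by (intro bilinear_system.intro) auto
  have t: "0 \<le> t" "t \<le> T" using assms(16) by auto
  have range: "\<bar>w s\<bar> * a \<le> 1 - \<delta>" if "w \<in> admissible_controls \<delta> a" for w s
  proof -
    have "w s \<in> {- ((1 - \<delta>) / a)<..<(1 - \<delta>) / a}"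
      using that range_subsetD unfolding admissible_controls_def by blast
    then have "\<bar>w s\<bar> < (1 - \<delta>) / a" by auto
    then show ?thesis using assms(2) by (simp add: field_simps)
  qed
  obtain M where M: "\<And>n \<sigma>. partition_of 0 T n \<sigma> \<Longrightarrow> variation_sum u n \<sigma> \<le> M"
    using assms(11) unfolding admissible_controls_def bounded_variation_def by blast
  have "total_variation 0 T u \<le> ereal M"
    unfolding total_variation_def by (rule Sup_least) (use M in auto)
  then have un_TV: "variation_sum (un n) k \<sigma> \<le> M" if "partition_of 0 T k \<sigma>" for n k \<sigma>
  proof -
    have "ereal (variation_sum (un n) k \<sigma>) \<le> total_variation 0 T (un n)"
      unfolding total_variation_def by (rule Sup_upper) (use that in auto)
    also have "\<dots> \<le> total_variation 0 T u" using assms(15) by blast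
    also have "\<dots> \<le> ereal M" by fact
    finally show ?thesis by simp
  qed
  define C where "C = exp (a / \<delta> * M) * (2 * norm (A \<psi>))"
  \<comment> \<open>The total variation bound makes the regularity constant \<open>C\<close> independent of \<open>n\<close>.\<close>
  have "\<exists>f. trajectory (un n) 0 t C f \<and> f 0 = \<psi> \<and> f t = propagator DA A DB B (un n) t \<psi> \<and>
      un n integrable_on {0..t}" for n
  proof -
    have "\<exists>ps. steps (un n) t ps"
      using assms(13) steps_restrict t(2) unfolding piecewise_constant_def by blast
    then obtain ps where ps: "steps (un n) t ps"
      "propagator DA A DB B (un n) t \<psi> = steps_propagator DA A DB B ps \<psi>"
      unfolding propagator_def using someI_ex by metis
    let ?v = "hd (map fst ps)"
    have st: "\<forall>(v, I)\<in>set ps. is_interval I \<and> I \<noteq> {} \<and> (\<forall>r\<in>I. un n r = v)"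
      "sorted_wrt (\<lambda>(_, I) (_, J). \<forall>x\<in>I. \<forall>y\<in>J. x < y) ps" "(\<Union>(v, I)\<in>set ps. I) = {0..t}"
      using ps(1) unfolding steps_def by auto
    have val: "\<bar>v\<bar> * a \<le> 1 - \<delta>" if vI: "(v, I) \<in> set ps" for v I
    proof -
      obtain r where "r \<in> I" "un n r = v" using st(1) vI by fastforce
      then show ?thesis using range[of "un n" r] assms(12) by auto
    qed
    have ne: "ps \<noteq> []" using st(3) t(1) by auto
    have "\<forall>(v, I)\<in>set ps. is_interval I \<and> I \<noteq> {} \<and> (\<forall>r\<in>I. un n r = v) \<and> \<bar>v\<bar> * a \<le> 1 - \<delta>"
      using st(1) val by fastforce
    from steps_trajectory[OF this st(2) ne st(3)[symmetric] _ _ assms(17)]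
    obtain f where f: "trajectory (un n) 0 t
        (exp (a / \<delta> * jumps (map fst ps)) * norm (A \<psi> + ?v *\<^sub>R B \<psi>)) f"
      "f 0 = \<psi>" "f t = steps_propagator DA A DB B ps \<psi>" "un n integrable_on {0..t}"
      using t by (auto simp: is_interval_cc)
    \<comment> \<open>The growth estimate starts from \<open>(A + v B) \<psi>\<close> with the first control value \<open>v\<close>.\<close>
    have "\<bar>?v\<bar> * a \<le> 1 - \<delta>" using val[of ?v "snd (hd ps)"] ne by (simp add: hd_map)
    then have "\<bar>?v\<bar> * a \<le> 1" using \<delta>_pos by linarith
    have "norm (?v *\<^sub>R B \<psi>) \<le> \<bar>?v\<bar> * (a * norm (A \<psi>))"
      using B_le[OF assms(17)] by (simp add: mult_left_mono)
    also have "\<dots> \<le> 1 * norm (A \<psi>)"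
      using mult_right_mono[OF \<open>\<bar>?v\<bar> * a \<le> 1\<close> norm_ge_zero[of "A \<psi>"]] by (simp add: mult.assoc)
    finally have "norm (A \<psi> + ?v *\<^sub>R B \<psi>) \<le> 2 * norm (A \<psi>)"
      using norm_triangle_ineq[of "A \<psi>" "?v *\<^sub>R B \<psi>"] by simp
    moreover have "jumps (map fst ps) \<le> M"
      by (rule steps_jumps_le_variation[OF un_TV ps(1) t])
    ultimately have "exp (a / \<delta> * jumps (map fst ps)) * norm (A \<psi> + ?v *\<^sub>R B \<psi>) \<le> C"
      unfolding C_def using a_pos \<delta>_pos by (intro mult_mono) (auto simp: divide_right_mono)
    with f ps(2) show ?thesis using trajectory_mono by metis
  qed
  then obtain f where f: "\<And>n. trajectory (un n) 0 t C (f n)" "\<And>n. f n 0 = \<psi>"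
    "\<And>n. f n t = propagator DA A DB B (un n) t \<psi>" and int_un: "\<And>n. un n integrable_on {0..t}"
    by metis
  let ?b = "(1 - \<delta>) / a"
  have un_le: "\<bar>un n s\<bar> \<le> ?b" and u_le: "\<bar>u s\<bar> \<le> ?b" for n s
    using range[of "un n" s] range[of u s] assms(2,11,12) by (simp_all add: field_simps)
  have int_u: "u integrable_on {0..t}"
    by (rule dominated_convergence(1)[of un _ "\<lambda>_. ?b"]) (use int_un un_le assms(14) in auto)
  have abs_int: "(\<lambda>s. \<bar>v s - w s\<bar>) integrable_on {0..t}"
    if "v integrable_on {0..t}" "w integrable_on {0..t}" "\<And>s. \<bar>v s\<bar> \<le> ?b" "\<And>s. \<bar>w s\<bar> \<le> ?b" for v w
  proof -
    have "(\<lambda>s. v s - w s) absolutely_integrable_on {0..t}"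
    proof (rule absolutely_integrable_integrable_bound[where g = "\<lambda>_. 2 * ?b"])
      show "norm (v s - w s) \<le> 2 * ?b" for s
        using that(3,4)[of s] unfolding real_norm_def by linarith
    qed (use that in \<open>auto intro: integrable_diff\<close>)
    then show ?thesis by (simp add: absolutely_integrable_on_def)
  qed
  define I where "I n = integral {0..t} (\<lambda>s. \<bar>un n s - u s\<bar>)" for n
  have I_int: "(\<lambda>s. \<bar>un n s - u s\<bar>) integrable_on {0..t}" for n
    by (rule abs_int[OF int_un int_u un_le u_le])
  have "I \<longlonglongrightarrow> integral {0..t} (\<lambda>s. 0 :: real)"
    unfolding I_def
  proof (rule dominated_convergence(2)[where h = "\<lambda>_. 2 * ?b", OF I_int])
    fix n s
    show "norm \<bar>un n s - u s\<bar> \<le> 2 * ?b"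
      using un_le[of n s] u_le[of s] unfolding real_norm_def by linarith
    show "(\<lambda>n. \<bar>un n s - u s\<bar>) \<longlonglongrightarrow> 0"
      using assms(14) by (intro tendsto_rabs_zero LIM_zero) blast
  qed auto
  then have I: "I \<longlonglongrightarrow> 0" by simp
  define c where "c = 4 * norm \<psi> * (a * C / \<delta>)"
  have "0 \<le> C" by (simp add: C_def)
  then have c: "0 \<le> c" using a_pos \<delta>_pos by (simp add: c_def)
  have key: "(norm (f n t - f m t))\<^sup>2 \<le> c * (I n + I m)" for n m
  proof -
    have int: "(\<lambda>s. \<bar>un n s - un m s\<bar>) integrable_on {0..t}"
      by (rule abs_int[OF int_un int_un un_le un_le])
    have "(norm (f n t - f m t))\<^sup>2 \<le> c * integral {0..t} (\<lambda>s. \<bar>un n s - un m s\<bar>)"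
      unfolding c_def by (rule trajectory_diff[OF f(1) f(1) f(2) f(2) int])
    also have "integral {0..t} (\<lambda>s. \<bar>un n s - un m s\<bar>)
        \<le> integral {0..t} (\<lambda>s. \<bar>un n s - u s\<bar> + \<bar>un m s - u s\<bar>)"
      by (intro integral_le int integrable_add I_int) auto
    also have "\<dots> = I n + I m" unfolding I_def by (rule integral_add[OF I_int I_int])
    finally show ?thesis using c by (simp add: mult_left_mono)
  qed
  have "Cauchy (\<lambda>n. f n t)"
  proof (rule metric_CauchyI)
    fix e :: real assume e: "e > 0"
    define \<epsilon> where "\<epsilon> = (e\<^sup>2 / 2) / (c + 1)"
    have \<epsilon>: "\<epsilon> > 0" using e c by (simp add: \<epsilon>_def)
    obtain N where N: "\<And>n. n \<ge> N \<Longrightarrow> I n < \<epsilon>"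
      using order_tendstoD(2)[OF I \<epsilon>] unfolding eventually_sequentially by blast
    have "dist (f m t) (f n t) < e" if "m \<ge> N" "n \<ge> N" for m n
    proof -
      have "(norm (f m t - f n t))\<^sup>2 \<le> c * (2 * \<epsilon>)"
        using order_trans[OF key mult_left_mono[OF _ c]] N[OF that(1)] N[OF that(2)] by fastforce
      also have "\<dots> < (c + 1) * (2 * \<epsilon>)" using \<epsilon> by (intro mult_strict_right_mono) auto
      also have "\<dots> = e\<^sup>2" using c unfolding \<epsilon>_def by (simp del: divide_divide_eq_left)
      finally have "(norm (f m t - f n t))\<^sup>2 < e\<^sup>2" .
      then show ?thesis unfolding dist_norm by (rule power2_less_imp_less) (use e in simp)
    qed
    then show "\<exists>N. \<forall>m\<ge>N. \<forall>n\<ge>N. dist (f m t) (f n t) < e" by blast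
  qed
  then show ?thesis by (simp add: f(3))
qed

end
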